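(* For each $n$ and threshold $t$, there exist quantum circuits of depth $O(1)$ (a constant independent of $n$ and $t$) implementing exactly the quantum operation $\mathrm{TH}_n^t$, with the following sizes: (i) size $O(n\log n)$ for any $1\le t\le \log n$ or $n-\log n\le t\le n$; (ii) size $O(n\sqrt{t\log n})$ for any $\log n\le t\le\lceil n/2\rceil$; (iii) size $O(n\sqrt{(n-t)\log n})$ for any $\lceil n/2\rceil\le t\le n-\log n$.
   Context: Quantum circuits are built from elementary gates: arbitrary one-qubit gates, CNOT gates, and unbounded fan-out gates. An unbounded fan-out gate on $k+1$ qubits ($k\ge1$) maps $|y\rangle\bigotimes_{j=0}^{k-1}|x_j\rangle \mapsto |y\rangle\bigotimes_{j=0}^{k-1}|x_j\oplus y\rangle$ for $y,x_j\in\{0,1\}$. Circuits may use ancillary qubits initialized to $|0\rangle$. The size of a circuit is the total over its gates of the number of qubits each gate acts on; the depth is the number of layers (input qubits have depth 0, a gate has depth 1 plus the maximal depth of gates it depends on, circuit depth is the maximal gate depth). For an integer $1\le t\le n$ and $x=x_0\cdots x_{n-1}\in\{0,1\}^n$, with $|x|=\sum_j x_j$ the Hamming weight, $\mathrm{TH}_n^t(x)=1$ if $|x|\ge t$ and $0$ otherwise; the quantum operation $\mathrm{TH}_n^t$ maps $\bigl(\bigotimes_{j}|x_j\rangle\bigr)|z\rangle\mapsto\bigl(\bigotimes_{j}|x_j\rangle\bigr)|z\oplus\mathrm{TH}_n^t(x)\rangle$. Logarithms are base 2. *)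

theory Defs
  imports Complex_Main
begin

text \<open>Qubits are indexed by natural numbers. A computational basis configuration is a
function nat => bool; a (pure) state assigns a complex amplitude to every configuration.
Qubits 0..n-1 hold the input x, qubit n holds z, and all qubits with index > n are
ancillas, initialised to 0 (False). A circuit only touches finitely many qubits.\<close>

type_synonym config = "nat \<Rightarrow> bool"
type_synonym qstate = "config \<Rightarrow> complex"

datatype gate =
    OneQ nat "bool \<Rightarrow> bool \<Rightarrow> complex"   \<comment> \<open>arbitrary one-qubit gate: qubit, 2x2 matrix U (row, column)\<close>
  | CNOT nat nat                        \<comment> \<open>control, target\<close>
  | FanOut nat "nat list"               \<comment> \<open>control y, targets x_0 .. x_(k-1)\<close>

definition unitary2 :: "(bool \<Rightarrow> bool \<Rightarrow> complex) \<Rightarrow> bool" where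
  "unitary2 U \<longleftrightarrow> (\<forall>i j. (\<Sum>k\<in>UNIV. cnj (U k i) * U k j) = (if i = j then 1 else 0))"

fun wf_gate :: "gate \<Rightarrow> bool" where
  "wf_gate (OneQ q U) = unitary2 U"
| "wf_gate (CNOT c tg) = (c \<noteq> tg)"
| "wf_gate (FanOut c T) = (T \<noteq> [] \<and> distinct T \<and> c \<notin> set T)"

fun gate_qubits :: "gate \<Rightarrow> nat set" where
  "gate_qubits (OneQ q U) = {q}"
| "gate_qubits (CNOT c tg) = {c, tg}"
| "gate_qubits (FanOut c T) = insert c (set T)"

fun gate_size :: "gate \<Rightarrow> nat" where
  "gate_size (OneQ q U) = 1"
| "gate_size (CNOT c tg) = 2"
| "gate_size (FanOut c T) = length T + 1"

fun apply_gate :: "gate \<Rightarrow> qstate \<Rightarrow> qstate" where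
  "apply_gate (OneQ q U) \<psi> = (\<lambda>x. \<Sum>b\<in>UNIV. U (x q) b * \<psi> (x(q := b)))"
| "apply_gate (CNOT c tg) \<psi> = (\<lambda>x. \<psi> (x(tg := (x tg \<noteq> x c))))"
| "apply_gate (FanOut c T) \<psi> = (\<lambda>x. \<psi> (\<lambda>i. if i \<in> set T then (x i \<noteq> x c) else x i))"

definition run_circuit :: "gate list \<Rightarrow> qstate \<Rightarrow> qstate" where
  "run_circuit gs \<psi> = fold apply_gate gs \<psi>"

definition circuit_size :: "gate list \<Rightarrow> nat" where
  "circuit_size gs = (\<Sum>g\<leftarrow>gs. gate_size g)"

text \<open>Depth: a gate has depth 1 + the maximal depth of earlier gates sharing a qubit with it
(input qubits have depth 0); we track for each qubit the depth of the last gate on it.\<close>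
definition depth_step :: "(nat \<Rightarrow> nat) \<times> nat \<Rightarrow> gate \<Rightarrow> (nat \<Rightarrow> nat) \<times> nat" where
  "depth_step dm g = (let v = Suc (Max (fst dm ` gate_qubits g))
                      in (\<lambda>q. if q \<in> gate_qubits g then v else fst dm q, max (snd dm) v))"

definition circuit_depth :: "gate list \<Rightarrow> nat" where
  "circuit_depth gs = snd (foldl depth_step (\<lambda>_. 0, 0) gs)"

definition basis :: "config \<Rightarrow> qstate" where
  "basis b = (\<lambda>x. if x = b then 1 else 0)"

definition input_config :: "nat \<Rightarrow> config \<Rightarrow> bool \<Rightarrow> config" where
  "input_config n x z = (\<lambda>i. if i < n then x i else if i = n then z else False)"

definition TH :: "nat \<Rightarrow> nat \<Rightarrow> config \<Rightarrow> bool" where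
  "TH n t x \<longleftrightarrow> t \<le> card {j. j < n \<and> x j}"

definition implements_TH :: "nat \<Rightarrow> nat \<Rightarrow> gate list \<Rightarrow> bool" where
  "implements_TH n t gs \<longleftrightarrow> (\<forall>g\<in>set gs. wf_gate g) \<and>
     (\<forall>x z. run_circuit gs (basis (input_config n x z))
            = basis (input_config n x (z \<noteq> TH n t x)))"

end

theory Submission
  imports Defs "HOL-Library.Countable" "HOL-Library.Nat_Bijection"
begin

text \<open>A Hadamard layer, a diagonal layer and a second Hadamard layer prepare, for target qubits \<open>u\<close>,
  the states \<open>(1 + e\<^sup>i\<^sup>\<theta>) / 2 |0\<rangle> + (1 - e\<^sup>i\<^sup>\<theta>) / 2 |1\<rangle>\<close>, where \<open>\<theta>\<close> is a linear form in other qubits.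
  The value of such a qubit is certain whenever \<open>\<theta>\<close> is a multiple of \<open>\<pi>\<close>; the other qubits stay
  in superposition, but the phase that finally hits the output depends only on what is certain.
  The Hamming weight \<open>s\<close> of a group differs from \<open>k\<close> iff some rotation by \<open>(s - k) \<pi> / 2\<^sup>a\<close> yields 1 with
  certainty, so the test \<open>s = k\<close> becomes an OR of logarithmically many qubits. A second round of rotations shortens this OR once more, and an
  OR of so few bits is a linear combination of all their parities, i.e. again a phase. Comparing
  with all \<open>k\<close> in parallel gives every symmetric function. The gate count is brought down by first
  counting inside blocks of \<open>2\<^sup>\<beta>\<close> inputs, then inside blocks of \<open>2\<^sup>\<beta>\<close> such counters, with
  \<open>8\<^sup>\<beta>\<close> about \<open>t log n\<close>. Everything except the last level is undone by running it backwards.\<close>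

section \<open>Gates, layers and depth\<close>

text \<open>Comparing the weight directly with every k in a set \<open>K\<close> costs about n |K|
  log n. Counting once, in blocks of B inputs, gives about n B log B + n |K| log n log B / B, whose
  optimum misses the target n sqrt(q), q = |K| log n, by a logarithm. After two rounds of counting
  the last comparison reads the digits of only about n / B^2 counters, so B^3 about q suffices; the
  cost is n q^(1/3) times powers of log q, and the spare factor q^(1/6) absorbs those. The threshold
  enters only through \<open>K\<close>: the weights below t with the answer negated, or the weights
  from t on, whichever set is short. A comparison by rotations leaves about log n bits, whose
  parities would number about n; this is why they are first reduced to about log log n bits. Bits in
  superposition have no definite value, so the proof tracks which configurations can carry nonzero
  amplitude and which relations hold on all of them. This suffices: the last phase is constant
  there, and undoing the preparation commutes with a flip of the output qubit.\<close>

lemma run_Nil [simp]: "run_circuit [] \<psi> = \<psi>"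
  by (simp add: run_circuit_def)

lemma run_Cons [simp]: "run_circuit (g # gs) \<psi> = run_circuit gs (apply_gate g \<psi>)"
  by (simp add: run_circuit_def)

lemma run_append [simp]: "run_circuit (gs @ hs) \<psi> = run_circuit hs (run_circuit gs \<psi>)"
  by (simp add: run_circuit_def)

lemma size_append [simp]: "circuit_size (gs @ hs) = circuit_size gs + circuit_size hs"
  by (simp add: circuit_size_def)

lemma size_Nil [simp]: "circuit_size [] = 0"
  by (simp add: circuit_size_def)

lemma size_Cons [simp]: "circuit_size (g # gs) = gate_size g + circuit_size gs"
  by (simp add: circuit_size_def)

definition parallel :: "gate list \<Rightarrow> bool" where
  "parallel gs \<longleftrightarrow> sorted_wrt (\<lambda>g h. gate_qubits g \<inter> gate_qubits h = {}) gs"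

lemma finite_gate_qubits [simp]: "finite (gate_qubits g)"
  by (cases g) auto

lemma gate_qubits_nonempty [simp]: "gate_qubits g \<noteq> {}"
  by (cases g) auto

text \<open>Inside a layer some qubits have already reached \<open>Suc e\<close>, while those of the
  gates still to come are at most at \<open>e\<close>. Both bounds are carried along; disjointness
  keeps the raised qubits away from the remaining gates.\<close>

lemma foldl_depth_parallel:
  assumes "parallel gs" "\<And>g q. g \<in> set gs \<Longrightarrow> q \<in> gate_qubits g \<Longrightarrow> fst p q \<le> e"
    and "\<And>q. fst p q \<le> Suc e" "snd p \<le> Suc e"
  shows "(\<forall>q. fst (foldl depth_step p gs) q \<le> Suc e) \<and> snd (foldl depth_step p gs) \<le> Suc e"
  using assms
proof (induction gs arbitrary: p)
  case (Cons g gs)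
  have M: "Max (fst p ` gate_qubits g) \<le> e"
    using Cons.prems(2)[of g] by (subst Max_le_iff) auto
  have disj: "gate_qubits g \<inter> gate_qubits h = {}" if "h \<in> set gs" for h
    using Cons.prems(1) that by (auto simp: parallel_def)
  have "(\<forall>q. fst (foldl depth_step (depth_step p g) gs) q \<le> Suc e)
      \<and> snd (foldl depth_step (depth_step p g) gs) \<le> Suc e"
  proof (rule Cons.IH)
    show "parallel gs" using Cons.prems(1) by (simp add: parallel_def)
    show "fst (depth_step p g) q \<le> e" if "h \<in> set gs" "q \<in> gate_qubits h" for h q
      using disj[OF that(1)] that Cons.prems(2)[of h q] by (auto simp: depth_step_def Let_def)
    show "fst (depth_step p g) q \<le> Suc e" for q
      using M Cons.prems(3) by (auto simp: depth_step_def Let_def)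
    show "snd (depth_step p g) \<le> Suc e"
      using M Cons.prems(4) by (auto simp: depth_step_def Let_def)
  qed
  then show ?case by simp
qed simp

lemma circuit_depth_concat:
  assumes "\<And>l. l \<in> set ls \<Longrightarrow> parallel l"
  shows "circuit_depth (concat ls) \<le> length ls"
proof -
  have "(\<forall>q. fst (foldl depth_step p (concat ls)) q \<le> e + length ls)
      \<and> snd (foldl depth_step p (concat ls)) \<le> e + length ls"
    if "\<And>q. fst p q \<le> e" "snd p \<le> e" for p e
    using assms that
  proof (induction ls arbitrary: p e)
    case (Cons l ls)
    have step: "(\<forall>q. fst (foldl depth_step p l) q \<le> Suc e) \<and> snd (foldl depth_step p l) \<le> Suc e"
      using Cons.prems by (intro foldl_depth_parallel) (auto simp: le_SucI)
    show ?case
      using Cons.IH[of "foldl depth_step p l" "Suc e"] step Cons.prems(1) by simp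
  qed simp
  from this[of "(\<lambda>_. 0, 0)" 0] show ?thesis by (simp add: circuit_depth_def)
qed

section \<open>Hadamard, phase and fan-out layers\<close>

definition had :: "bool \<Rightarrow> bool \<Rightarrow> complex" where
  "had i j = (if i \<and> j then - 1 else 1) / sqrt 2"

definition phase :: "real \<Rightarrow> bool \<Rightarrow> bool \<Rightarrow> complex" where
  "phase \<theta> i j = (if i = j then if i then cis \<theta> else 1 else 0)"

lemma had_mult: "had i j * had k l = (if (i \<and> j) = (k \<and> l) then 1 / 2 else - 1 / 2)"
proof -
  have "complex_of_real (sqrt 2) * complex_of_real (sqrt 2) = 2"
    by (simp flip: of_real_mult)
  then show ?thesis by (auto simp: had_def)
qed

lemma had_squared: "(\<Sum>b\<in>UNIV. had i b * had b j) = (if i = j then 1 else 0)"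
  by (cases i; cases j) (simp_all add: UNIV_bool had_mult)

lemma unitary2_had: "unitary2 had"
proof -
  have "cnj (had i j) = had j i" for i j by (simp add: had_def)
  then show ?thesis by (simp add: unitary2_def had_squared)
qed

lemma unitary2_phase: "unitary2 (phase \<theta>)"
  by (auto simp: unitary2_def phase_def UNIV_bool cis_cnj cis_mult)

definition hads :: "nat list \<Rightarrow> gate list" where
  "hads qs = map (\<lambda>q. OneQ q had) qs"

definition phases :: "(nat \<Rightarrow> real) \<Rightarrow> nat list \<Rightarrow> gate list" where
  "phases \<phi> qs = map (\<lambda>q. OneQ q (phase (\<phi> q))) qs"

definition fans :: "(nat \<Rightarrow> nat list) \<Rightarrow> nat list \<Rightarrow> gate list" where
  "fans T qs = map (\<lambda>q. FanOut q (T q)) qs"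

lemma apply_had_had: "apply_gate (OneQ q had) (apply_gate (OneQ q had) \<psi>) = \<psi>"
proof
  fix x
  have "apply_gate (OneQ q had) (apply_gate (OneQ q had) \<psi>) x
      = (\<Sum>b\<in>UNIV. \<Sum>c\<in>UNIV. had (x q) b * had b c * \<psi> (x(q := c)))"
    by (simp add: sum_distrib_left mult.assoc)
  also have "\<dots> = (\<Sum>c\<in>UNIV. (\<Sum>b\<in>UNIV. had (x q) b * had b c) * \<psi> (x(q := c)))"
    by (subst sum.swap) (simp add: sum_distrib_right)
  also have "\<dots> = (\<Sum>c\<in>UNIV. if c = x q then \<psi> (x(q := c)) else 0)"
    by (intro sum.cong refl) (simp add: had_squared)
  finally show "apply_gate (OneQ q had) (apply_gate (OneQ q had) \<psi>) x = \<psi> x"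
    by simp
qed

lemma run_hads_rev: "run_circuit (hads (rev qs)) (run_circuit (hads qs) \<psi>) = \<psi>"
  by (induction qs arbitrary: \<psi>) (simp_all add: hads_def apply_had_had del: apply_gate.simps)

lemma run_phases:
  "distinct qs \<Longrightarrow>
   run_circuit (phases \<phi> qs) \<psi> = (\<lambda>x. cis (\<Sum>q\<in>set qs. \<phi> q * of_bool (x q)) * \<psi> x)"
proof (induction qs arbitrary: \<psi>)
  case (Cons q qs)
  have "apply_gate (OneQ q (phase (\<phi> q))) \<psi> = (\<lambda>x. cis (\<phi> q * of_bool (x q)) * \<psi> x)"
    by (rule ext, rename_tac x, case_tac "x q") (auto simp: UNIV_bool phase_def fun_upd_idem)
  moreover have "cis (\<Sum>r\<in>set qs. \<phi> r * of_bool (x r)) * (cis (\<phi> q * of_bool (x q)) * \<psi> x)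
      = cis (\<Sum>r\<in>set (q # qs). \<phi> r * of_bool (x r)) * \<psi> x" for x
    using Cons.prems
    by (simp add: add.commute flip: mult.assoc cis_mult del: sum_mult_of_bool_eq)
  ultimately show ?case
    using Cons unfolding phases_def by (simp only: list.map run_Cons distinct.simps)
qed (simp add: phases_def)

text \<open>\<open>src\<close> names the control of each target, so the target lists are disjoint;
  as no control is a target, the gates do not see each other and act as one simultaneous
  XOR.\<close>

lemma run_fans:
  assumes "distinct qs"
    and "\<And>q i. q \<in> set qs \<Longrightarrow> i \<in> set (T q) \<Longrightarrow> src i = q"
    and "\<And>q q'. q \<in> set qs \<Longrightarrow> q' \<in> set qs \<Longrightarrow> q \<notin> set (T q')"
  shows "run_circuit (fans T qs) \<psi>
       = (\<lambda>x. \<psi> (\<lambda>i. if \<exists>q\<in>set qs. i \<in> set (T q) then x i \<noteq> x (src i) else x i))"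
  using assms
proof (induction qs arbitrary: \<psi>)
  case (Cons q qs)
  have IH: "run_circuit (fans T qs) \<psi>
       = (\<lambda>x. \<psi> (\<lambda>i. if \<exists>q\<in>set qs. i \<in> set (T q) then x i \<noteq> x (src i) else x i))" for \<psi>
    using Cons by auto
  have src: "src i = q" if "i \<in> set (T q)" for i
    using Cons.prems(2) that by simp
  have no: "\<not> (\<exists>q'\<in>set qs. i \<in> set (T q'))" if "i \<in> set (T q)" for i
    using Cons.prems(1,2) that by (metis distinct.simps(2) list.set_intros)
  have q: "q \<notin> set (T q')" if "q' \<in> set (q # qs)" for q'
    using Cons.prems(3) that by simp
  show ?case
  proof
    fix x
    define P where "P i = (if \<exists>q\<in>set qs. i \<in> set (T q) then x i \<noteq> x (src i) else x i)" for i
    have "P q = x q" using q by (simp add: P_def)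
    then have "(\<lambda>i. if i \<in> set (T q) then P i \<noteq> P q else P i)
        = (\<lambda>i. if \<exists>q\<in>set (q # qs). i \<in> set (T q) then x i \<noteq> x (src i) else x i)"
      using src no by (auto simp: fun_eq_iff P_def)
    moreover have "run_circuit (fans T (q # qs)) \<psi> x
        = \<psi> (\<lambda>i. if i \<in> set (T q) then P i \<noteq> P q else P i)"
      unfolding P_def fans_def
      by (simp only: list.map run_Cons IH[unfolded fans_def] apply_gate.simps)
    ultimately show "run_circuit (fans T (q # qs)) \<psi> x
        = \<psi> (\<lambda>i. if \<exists>q\<in>set (q # qs). i \<in> set (T q) then x i \<noteq> x (src i) else x i)"
      by (simp only:)
  qed
qed (simp add: fans_def)

text \<open>The factor of qubit \<open>r\<close> may depend on qubits outside the layer, such as the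
  controls that set its rotation angle, and on the layer only through its last argument. Hence each
  gate transforms exactly one factor. Both Hadamard layers of a level have this form.\<close>

lemma run_hads_product:
  assumes "distinct qs"
    and "\<And>y q b. q \<in> set qs \<Longrightarrow> g (y(q := b)) = g y"
    and "\<And>y q r b c. q \<in> set qs \<Longrightarrow> f r (y(q := b)) c = f r y c"
  shows "run_circuit (hads qs) (\<lambda>y. g y * (\<Prod>r\<in>set qs. f r y (y r)))
       = (\<lambda>y. g y * (\<Prod>r\<in>set qs. \<Sum>b\<in>UNIV. had (y r) b * f r y b))"
  using assms
proof (induction qs arbitrary: g)
  case (Cons q qs)
  define g' where "g' y = g y * (\<Sum>b\<in>UNIV. had (y q) b * f q y b)" for y
  have q: "q \<notin> set qs" using Cons.prems(1) by simp
  have "apply_gate (OneQ q had) (\<lambda>y. g y * (\<Prod>r\<in>set (q # qs). f r y (y r)))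
      = (\<lambda>y. g' y * (\<Prod>r\<in>set qs. f r y (y r)))"
  proof
    fix y
    have "f r (y(q := b)) ((y(q := b)) r) = f r y (y r)" if "r \<in> set qs" for r b
      using Cons.prems(3)[of q r y b] q that by (metis fun_upd_other list.set_intros(1))
    then have "(\<Prod>r\<in>set qs. f r (y(q := b)) ((y(q := b)) r)) = (\<Prod>r\<in>set qs. f r y (y r))" for b
      by (intro prod.cong refl)
    moreover have "g (y(q := b)) = g y" "f q (y(q := b)) c = f q y c" for b c
      using Cons.prems(2)[of q y b] Cons.prems(3)[of q q y b c] by (simp_all only: list.set_intros)
    ultimately have "g (y(q := b)) * (\<Prod>r\<in>set (q # qs). f r (y(q := b)) ((y(q := b)) r))
        = g y * f q y b * (\<Prod>r\<in>set qs. f r y (y r))" for b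
      using q by (simp only: list.set prod.insert finite_set not_False_eq_True fun_upd_same mult.assoc)
    then show "apply_gate (OneQ q had) (\<lambda>y. g y * (\<Prod>r\<in>set (q # qs). f r y (y r))) y
      = g' y * (\<Prod>r\<in>set qs. f r y (y r))"
      by (simp only: apply_gate.simps g'_def sum_distrib_left sum_distrib_right mult_ac)
  qed
  moreover have "run_circuit (hads qs) (\<lambda>y. g' y * (\<Prod>r\<in>set qs. f r y (y r)))
       = (\<lambda>y. g' y * (\<Prod>r\<in>set qs. \<Sum>b\<in>UNIV. had (y r) b * f r y b))"
  proof (rule Cons.IH)
    fix y r b assume r: "r \<in> set qs"
    then have "r \<noteq> q" using q by blast
    then show "g' (y(r := b)) = g' y"
      unfolding g'_def using Cons.prems(2)[of r y b] Cons.prems(3)[of r q y b] r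
      by (simp only: fun_upd_other list.set_intros not_sym)
  qed (use Cons.prems in auto)
  ultimately show ?case
    using q by (simp add: hads_def g'_def mult.assoc del: apply_gate.simps)
qed (simp add: hads_def)

section \<open>Rotation levels\<close>

definition list_of :: "nat set \<Rightarrow> nat list" where
  "list_of S = sorted_list_of_set S"

lemma list_of [simp]:
  assumes "finite S"
  shows "set (list_of S) = S" "distinct (list_of S)" "length (list_of S) = card S"
  using assms by (simp_all add: list_of_def)

text \<open>The qubits above \<open>n\<close> are split by parity into named ancillas and one scratch qubit for every
  pair of qubits, so no bookkeeping of fresh indices is needed.\<close>
definition anc :: "nat \<Rightarrow> nat list \<Rightarrow> nat" where
  "anc n xs = n + 2 + 2 * to_nat xs"

definition scratch :: "nat \<Rightarrow> nat \<Rightarrow> nat \<Rightarrow> nat" where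
  "scratch n u v = n + 1 + 2 * prod_encode (u, v)"

definition anc_index :: "nat \<Rightarrow> nat \<Rightarrow> nat list" where
  "anc_index n q = from_nat ((q - n - 2) div 2)"

definition scratch_src :: "nat \<Rightarrow> nat \<Rightarrow> nat \<times> nat" where
  "scratch_src n q = prod_decode ((q - n - 1) div 2)"

lemma anc_index [simp]: "anc_index n (anc n xs) = xs"
  by (simp add: anc_index_def anc_def)

lemma anc_eq [simp]: "anc n xs = anc n ys \<longleftrightarrow> xs = ys"
  by (metis anc_index)

lemma scratch_src [simp]: "scratch_src n (scratch n u v) = (u, v)"
  by (simp add: scratch_src_def scratch_def)

lemma scratch_eq [simp]: "scratch n u v = scratch n u' v' \<longleftrightarrow> u = u' \<and> v = v'"
  by (metis scratch_src prod.inject)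

lemma anc_gt [simp]: "n < anc n xs" "anc n xs \<noteq> n" "n \<noteq> anc n xs"
  by (auto simp: anc_def)

lemma scratch_gt [simp]: "n < scratch n u v" "scratch n u v \<noteq> n" "n \<noteq> scratch n u v"
  by (auto simp: scratch_def)

lemma anc_scratch [simp]: "anc n xs \<noteq> scratch n u v" "scratch n u v \<noteq> anc n xs"
proof -
  have "even (anc n xs - n)" "odd (scratch n u v - n)" by (simp_all add: anc_def scratch_def)
  then show "anc n xs \<noteq> scratch n u v" "scratch n u v \<noteq> anc n xs" by metis+
qed

definition scratches :: "nat \<Rightarrow> nat set" where
  "scratches n = {q. \<exists>u v. q = scratch n u v}"

text \<open>An edge leads from a target qubit to a qubit that controls it. The rotation angle of a
  target is affine in the bits of its controls, see \<open>theta\<close>.\<close>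

datatype level = Level
  (tgt: "nat set") (edg: "(nat \<times> nat) set") (ang: "nat \<Rightarrow> nat \<Rightarrow> real") (off: "nat \<Rightarrow> real")

definition level_ok :: "nat \<Rightarrow> level \<Rightarrow> bool" where
  "level_ok n L \<longleftrightarrow> finite (tgt L) \<and> finite (edg L) \<and> Domain (edg L) \<subseteq> tgt L \<and>
     Range (edg L) \<inter> tgt L = {} \<and> tgt L \<inter> scratches n = {} \<and> Range (edg L) \<inter> scratches n = {}"

definition theta :: "level \<Rightarrow> config \<Rightarrow> nat \<Rightarrow> real" where
  "theta L x u = off L u + (\<Sum>v\<in>edg L `` {u}. ang L u v * of_bool (x v))"

text \<open>The product of bits is diagonalised by
  \<open>2 x\<^sub>u x\<^sub>v = x\<^sub>u + x\<^sub>v - (x\<^sub>u \<oplus> x\<^sub>v)\<close>; the parity of every edge is held in its own scratch qubit,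
  so all phases of a level are applied at the same time.\<close>

definition fan_src :: "nat \<Rightarrow> level \<Rightarrow> nat \<Rightarrow> nat list" where
  "fan_src n L u = map (scratch n u) (list_of (edg L `` {u}))"

definition fan_dst :: "nat \<Rightarrow> level \<Rightarrow> nat \<Rightarrow> nat list" where
  "fan_dst n L v = map (\<lambda>u. scratch n u v) (list_of ((edg L)\<inverse> `` {v}))"

definition edge_phase :: "nat \<Rightarrow> level \<Rightarrow> nat \<Rightarrow> real" where
  "edge_phase n L q = - ang L (fst (scratch_src n q)) (snd (scratch_src n q)) / 2"

definition src_phase :: "level \<Rightarrow> nat \<Rightarrow> real" where
  "src_phase L u = off L u + (\<Sum>v\<in>edg L `` {u}. ang L u v / 2)"

definition dst_phase :: "level \<Rightarrow> nat \<Rightarrow> real" where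
  "dst_phase L v = (\<Sum>u\<in>(edg L)\<inverse> `` {v}. ang L u v / 2)"

definition edge_qubits :: "nat \<Rightarrow> level \<Rightarrow> nat set" where
  "edge_qubits n L = (\<lambda>(u, v). scratch n u v) ` edg L"

text \<open>The fan-outs are repeated to restore the scratch qubits after their phases. The last
  Hadamard layer is reversed so that, when a level is followed by its negative, equal gates meet and
  cancel from the inside out.\<close>

definition level_layers :: "nat \<Rightarrow> level \<Rightarrow> gate list list" where
  "level_layers n L =
    (let us = list_of (Domain (edg L)); vs = list_of (Range (edg L)); rs = list_of (tgt L) in
     [hads rs, fans (fan_src n L) us, fans (fan_dst n L) vs,
      phases (edge_phase n L) (list_of (edge_qubits n L)),
      fans (fan_dst n L) vs, fans (fan_src n L) us,
      phases (src_phase L) rs, phases (dst_phase L) vs, hads (rev rs)])"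

definition level_circuit :: "nat \<Rightarrow> level \<Rightarrow> gate list" where
  "level_circuit n L = concat (level_layers n L)"

text \<open>The phase of the seven inner layers on an arbitrary configuration, without assuming
  clear scratch qubits, so that \<open>run_neg_level\<close> can be stated for every state.\<close>

definition diag_angle :: "nat \<Rightarrow> level \<Rightarrow> config \<Rightarrow> real" where
  "diag_angle n L x =
     (\<Sum>q\<in>edge_qubits n L. edge_phase n L q *
        of_bool (x q \<noteq> (x (fst (scratch_src n q)) \<noteq> x (snd (scratch_src n q)))))
   + (\<Sum>u\<in>tgt L. src_phase L u * of_bool (x u))
   + (\<Sum>v\<in>Range (edg L). dst_phase L v * of_bool (x v))"

lemma level_okD:
  assumes "level_ok n L"
  shows "finite (tgt L)" "finite (edg L)" "\<And>u v. (u, v) \<in> edg L \<Longrightarrow> u \<in> tgt L"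
    "\<And>u v. (u, v) \<in> edg L \<Longrightarrow> v \<notin> tgt L" "\<And>u v. scratch n u v \<notin> tgt L"
    "\<And>u v w. (w, scratch n u v) \<notin> edg L" "\<And>u v w. (scratch n u v, w) \<notin> edg L"
    "finite (edg L `` S)" "finite ((edg L)\<inverse> `` S)"
proof -
  have *: "finite (tgt L)" "finite (edg L)" "Domain (edg L) \<subseteq> tgt L"
    "Range (edg L) \<inter> tgt L = {}" "tgt L \<inter> scratches n = {}" "Range (edg L) \<inter> scratches n = {}"
    using assms by (simp_all add: level_ok_def)
  have sc: "scratch n u v \<in> scratches n" for u v by (auto simp: scratches_def)
  show fin: "finite (tgt L)" "finite (edg L)" using * by simp_all
  show t: "u \<in> tgt L" "v \<notin> tgt L" if "(u, v) \<in> edg L" for u v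
    using * that by blast+
  show s: "scratch n u v \<notin> tgt L" for u v using * sc by blast
  show "(w, scratch n u v) \<notin> edg L" for u v w
    using *(6) sc[of u v] by blast
  show "(scratch n u v, w) \<notin> edg L" for u v w using t(1) s by blast
  show "finite (edg L `` S)" "finite ((edg L)\<inverse> `` S)"
    using fin by simp_all
qed

lemma level_circuit_inner:
  assumes ok: "level_ok n L"
  shows "level_circuit n L = hads (list_of (tgt L)) @
     (fans (fan_src n L) (list_of (Domain (edg L))) @ fans (fan_dst n L) (list_of (Range (edg L))) @
      phases (edge_phase n L) (list_of (edge_qubits n L)) @
      fans (fan_dst n L) (list_of (Range (edg L))) @ fans (fan_src n L) (list_of (Domain (edg L))) @
      phases (src_phase L) (list_of (tgt L)) @ phases (dst_phase L) (list_of (Range (edg L)))) @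
     hads (rev (list_of (tgt L)))"
  by (simp add: level_circuit_def level_layers_def Let_def)

lemma in_edge_qubits: "q \<in> edge_qubits n L \<longleftrightarrow> (\<exists>u v. (u, v) \<in> edg L \<and> q = scratch n u v)"
  by (auto simp: edge_qubits_def)

lemma set_fan_src: "level_ok n L \<Longrightarrow> set (fan_src n L u) = scratch n u ` (edg L `` {u})"
  by (simp add: fan_src_def level_okD)

lemma set_fan_dst: "level_ok n L \<Longrightarrow> set (fan_dst n L v) = (\<lambda>u. scratch n u v) ` ((edg L)\<inverse> `` {v})"
  by (simp add: fan_dst_def level_okD)

lemma run_fan_src:
  assumes ok: "level_ok n L"
  shows "run_circuit (fans (fan_src n L) (list_of (Domain (edg L)))) \<psi> =
    (\<lambda>x. \<psi> (\<lambda>q. if q \<in> edge_qubits n L then x q \<noteq> x (fst (scratch_src n q)) else x q))"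
proof -
  note L = level_okD[OF ok]
  have "(\<exists>u\<in>set (list_of (Domain (edg L))). q \<in> set (fan_src n L u)) \<longleftrightarrow> q \<in> edge_qubits n L" for q
    using L(2) by (auto simp: in_edge_qubits set_fan_src[OF ok] finite_Domain)
  moreover have "run_circuit (fans (fan_src n L) (list_of (Domain (edg L)))) \<psi> =
    (\<lambda>x. \<psi> (\<lambda>q. if \<exists>u\<in>set (list_of (Domain (edg L))). q \<in> set (fan_src n L u)
      then x q \<noteq> x ((fst \<circ> scratch_src n) q) else x q))"
    using L by (intro run_fans) (auto simp: finite_Domain set_fan_src[OF ok])
  ultimately show ?thesis by simp
qed

lemma run_fan_dst:
  assumes ok: "level_ok n L"
  shows "run_circuit (fans (fan_dst n L) (list_of (Range (edg L)))) \<psi> =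
    (\<lambda>x. \<psi> (\<lambda>q. if q \<in> edge_qubits n L then x q \<noteq> x (snd (scratch_src n q)) else x q))"
proof -
  note L = level_okD[OF ok]
  have "(\<exists>u\<in>set (list_of (Range (edg L))). q \<in> set (fan_dst n L u)) \<longleftrightarrow> q \<in> edge_qubits n L" for q
    using L(2) by (auto simp: in_edge_qubits set_fan_dst[OF ok] finite_Range)
  moreover have "run_circuit (fans (fan_dst n L) (list_of (Range (edg L)))) \<psi> =
    (\<lambda>x. \<psi> (\<lambda>q. if \<exists>u\<in>set (list_of (Range (edg L))). q \<in> set (fan_dst n L u)
      then x q \<noteq> x ((snd \<circ> scratch_src n) q) else x q))"
    using L by (intro run_fans) (auto simp: finite_Range set_fan_dst[OF ok])
  ultimately show ?thesis by simp
qed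

text \<open>The fan-out maps \<open>ps\<close> and \<open>pd\<close> are involutions: their
  repetition removes them from the argument of the state and leaves them only inside the edge
  phases.\<close>

lemma run_level_circuit:
  assumes ok: "level_ok n L"
  shows "run_circuit (level_circuit n L) \<psi> = run_circuit (hads (rev (list_of (tgt L))))
     (\<lambda>x. cis (diag_angle n L x) * run_circuit (hads (list_of (tgt L))) \<psi> x)"
proof -
  note L = level_okD[OF ok]
  define S where "S = edge_qubits n L"
  define s where "s q = fst (scratch_src n q)" for q
  define d where "d q = snd (scratch_src n q)" for q
  have finS: "finite S" using L by (simp add: S_def edge_qubits_def)
  have notS: "s q \<notin> S" "d q \<notin> S" if "q \<in> S" for q
    using that L by (auto simp: S_def edge_qubits_def s_def d_def)
  define \<chi> where "\<chi> = run_circuit (hads (list_of (tgt L))) \<psi>"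
  define ps where "ps x = (\<lambda>q. if q \<in> S then x q \<noteq> x (s q) else x q)" for x :: config
  define pd where "pd x = (\<lambda>q. if q \<in> S then x q \<noteq> x (d q) else x q)" for x :: config
  have inv: "ps (ps x) = x" "pd (pd x) = x" for x
    using notS by (auto simp: ps_def pd_def fun_eq_iff)
  have both: "pd (ps x) q = (x q \<noteq> (x (s q) \<noteq> x (d q)))" if "q \<in> S" for x q
    using that notS by (auto simp: ps_def pd_def)
  note runs = run_fan_src[OF ok, folded S_def, folded s_def, folded ps_def]
    run_fan_dst[OF ok, folded S_def, folded d_def, folded pd_def]
  have "run_circuit (level_circuit n L) \<psi> = run_circuit (hads (rev (list_of (tgt L))))
    (\<lambda>x. cis (\<Sum>v\<in>Range (edg L). dst_phase L v * of_bool (x v)) *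
     (cis (\<Sum>u\<in>tgt L. src_phase L u * of_bool (x u)) *
     (cis (\<Sum>q\<in>S. edge_phase n L q * of_bool (pd (ps x) q)) * \<chi> x)))"
    using L finS
    by (simp add: finite_Range level_circuit_inner[OF ok] run_phases runs inv S_def[symmetric] \<chi>_def[symmetric]
        del: sum_mult_of_bool_eq)
  moreover have "(\<Sum>q\<in>S. edge_phase n L q * of_bool (pd (ps x) q))
     = (\<Sum>q\<in>S. edge_phase n L q * of_bool (x q \<noteq> (x (s q) \<noteq> x (d q))))" for x
    by (rule sum.cong) (simp_all only: both)
  ultimately show ?thesis
    by (simp add: diag_angle_def S_def s_def d_def \<chi>_def mult_ac add_ac flip: cis_mult
        del: sum_mult_of_bool_eq)
qed

definition neg_level :: "level \<Rightarrow> level" where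
  "neg_level L = Level (tgt L) (edg L) (\<lambda>u v. - ang L u v) (\<lambda>u. - off L u)"

lemma neg_level_simps [simp]: "tgt (neg_level L) = tgt L" "edg (neg_level L) = edg L"
  by (simp_all add: neg_level_def)

lemma level_ok_neg: "level_ok n L \<Longrightarrow> level_ok n (neg_level L)"
  by (simp add: level_ok_def)

lemma diag_angle_neg: "diag_angle n (neg_level L) x = - diag_angle n L x"
proof -
  have "edge_phase n (neg_level L) q = - edge_phase n L q"
    "src_phase (neg_level L) q = - src_phase L q" "dst_phase (neg_level L) q = - dst_phase L q" for q
    by (simp_all add: edge_phase_def src_phase_def dst_phase_def neg_level_def sum_negf)
  then show ?thesis
    by (simp add: diag_angle_def edge_qubits_def sum_negf del: sum_mult_of_bool_eq)
qed

text \<open>The adjacent Hadamard layers cancel first, then the opposite diagonal phases, then the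
  outer Hadamard layers.\<close>

lemma run_neg_level:
  assumes "level_ok n L"
  shows "run_circuit (level_circuit n (neg_level L)) (run_circuit (level_circuit n L) \<psi>) = \<psi>"
proof -
  have c: "cis (- a) * (cis a * y) = y" for a and y :: complex
    by (simp add: cis_mult flip: mult.assoc)
  have r: "run_circuit (hads qs) (run_circuit (hads (rev qs)) \<psi>) = \<psi>" for qs \<psi>
    using run_hads_rev[of "rev qs"] by simp
  show ?thesis
    using assms by (simp add: run_level_circuit level_ok_neg diag_angle_neg c r run_hads_rev)
qed

text \<open>The edge phases come grouped by edge and the \<open>dst_phase\<close> terms by control.
  Both are regrouped by target, where the identity for a product of two bits turns them into
  controlled rotations.\<close>

lemma diag_angle_eq:
  assumes ok: "level_ok n L" and x: "\<And>q. q \<in> scratches n \<Longrightarrow> \<not> x q"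
  shows "diag_angle n L x = (\<Sum>u\<in>tgt L. theta L x u * of_bool (x u))"
proof -
  note L = level_okD[OF ok]
  have E: "edg L = Sigma (tgt L) (\<lambda>u. edg L `` {u})" using L by auto
  have E': "(\<Sum>(u, v)\<in>edg L. h u v) = (\<Sum>u\<in>tgt L. \<Sum>v\<in>edg L `` {u}. h u v)"
    for h :: "nat \<Rightarrow> nat \<Rightarrow> real"
    by (subst E) (rule sum.Sigma[symmetric], use L in auto)
  have "(\<Sum>q\<in>edge_qubits n L. edge_phase n L q *
        of_bool (x q \<noteq> (x (fst (scratch_src n q)) \<noteq> x (snd (scratch_src n q)))))
      = (\<Sum>(u, v)\<in>edg L. - ang L u v / 2 * of_bool (x u \<noteq> x v))"
    unfolding edge_qubits_def
    by (subst sum.reindex) (auto simp: inj_on_def edge_phase_def x scratches_def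
        simp del: sum_mult_of_bool_eq intro!: sum.cong)
  also have "\<dots> = (\<Sum>u\<in>tgt L. \<Sum>v\<in>edg L `` {u}. - ang L u v / 2 * of_bool (x u \<noteq> x v))"
    by (rule E')
  finally have 1: "(\<Sum>q\<in>edge_qubits n L. edge_phase n L q *
        of_bool (x q \<noteq> (x (fst (scratch_src n q)) \<noteq> x (snd (scratch_src n q)))))
     = (\<Sum>u\<in>tgt L. \<Sum>v\<in>edg L `` {u}. - ang L u v / 2 * of_bool (x u \<noteq> x v))" .
  have "(\<Sum>v\<in>Range (edg L). dst_phase L v * of_bool (x v))
     = (\<Sum>v\<in>Range (edg L). \<Sum>u\<in>(edg L)\<inverse> `` {v}. ang L u v / 2 * of_bool (x v))"
    by (simp add: dst_phase_def sum_distrib_right del: sum_mult_of_bool_eq)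
  also have "\<dots> = (\<Sum>(v, u)\<in>Sigma (Range (edg L)) (\<lambda>v. (edg L)\<inverse> `` {v}). ang L u v / 2 * of_bool (x v))"
    by (rule sum.Sigma) (use L in \<open>auto simp: finite_Range\<close>)
  also have "\<dots> = (\<Sum>(u, v)\<in>edg L. ang L u v / 2 * of_bool (x v))"
    by (rule sum.reindex_bij_witness[of _ prod.swap prod.swap]) auto
  also have "\<dots> = (\<Sum>u\<in>tgt L. \<Sum>v\<in>edg L `` {u}. ang L u v / 2 * of_bool (x v))"
    by (rule E')
  finally have 2: "(\<Sum>v\<in>Range (edg L). dst_phase L v * of_bool (x v))
     = (\<Sum>u\<in>tgt L. \<Sum>v\<in>edg L `` {u}. ang L u v / 2 * of_bool (x v))" .
  have 3: "(\<Sum>v\<in>edg L `` {u}. - ang L u v / 2 * of_bool (x u \<noteq> x v))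
      + src_phase L u * of_bool (x u) + (\<Sum>v\<in>edg L `` {u}. ang L u v / 2 * of_bool (x v))
      = theta L x u * of_bool (x u)" for u
  proof -
    have "(\<Sum>v\<in>edg L `` {u}. - ang L u v / 2 * of_bool (x u \<noteq> x v))
      + (\<Sum>v\<in>edg L `` {u}. ang L u v / 2 * of_bool (x u))
      + (\<Sum>v\<in>edg L `` {u}. ang L u v / 2 * of_bool (x v))
      = (\<Sum>v\<in>edg L `` {u}. ang L u v * of_bool (x v) * of_bool (x u))"
      unfolding sum.distrib[symmetric] by (rule sum.cong) (auto simp: of_bool_def)
    then show ?thesis
      unfolding src_phase_def theta_def distrib_right sum_distrib_right by linarith
  qed
  show ?thesis
    unfolding diag_angle_def 1 2 by (simp only: sum.distrib[symmetric] 3)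
qed

section \<open>Supports of prepared states\<close>

lemma cis_sum: "finite A \<Longrightarrow> cis (\<Sum>a\<in>A. f a) = (\<Prod>a\<in>A. cis (f a))"
  by (induction A rule: finite_induct) (simp_all flip: cis_mult)

lemma theta_cong:
  assumes "\<And>v. (u, v) \<in> edg L \<Longrightarrow> x v = y v"
  shows "theta L x u = theta L y u"
  unfolding theta_def using assms by (intro arg_cong2[where f="(+)"] sum.cong) auto

text \<open>All that is remembered about a superposed target: angles that are multiples of pi fix
  its value, every other angle leaves both values possible.\<close>

definition level_sat :: "level \<Rightarrow> config \<Rightarrow> bool" where
  "level_sat L x \<longleftrightarrow> (\<forall>r\<in>tgt L. (cis (theta L x r) = 1 \<longrightarrow> \<not> x r) \<and> (cis (theta L x r) = - 1 \<longrightarrow> x r))"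

definition zero_on :: "nat set \<Rightarrow> config \<Rightarrow> config" where
  "zero_on R x = (\<lambda>q. if q \<in> R then False else x q)"

text \<open>Targets that start at 0 stay independent of each other given the controls, although the
  controls may themselves be in superposition.\<close>

lemma run_level_product:
  assumes ok: "level_ok n L"
    and supp: "\<forall>x. \<psi> x \<noteq> 0 \<longrightarrow> (\<forall>q\<in>tgt L \<union> scratches n. \<not> x q)"
  shows "run_circuit (level_circuit n L) \<psi> = (\<lambda>x. \<psi> (zero_on (tgt L) x) *
     (\<Prod>r\<in>tgt L. \<Sum>b\<in>UNIV. had (x r) b * (cis (theta L x r * of_bool b) * had b False)))"
proof -
  note L = level_okD[OF ok]
  define R where "R = tgt L"
  define rs where "rs = list_of R"
  have rs: "set rs = R" "distinct rs" using L by (simp_all add: rs_def R_def)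
  \<comment> \<open>The support condition on the targets becomes a product of indicator factors, the
    form that \<open>run_hads_product\<close> consumes.\<close>
  have \<psi>: "\<psi> = (\<lambda>y. \<psi> (zero_on R y) * (\<Prod>r\<in>set rs. of_bool (\<not> y r)))"
  proof
    fix y
    show "\<psi> y = \<psi> (zero_on R y) * (\<Prod>r\<in>set rs. of_bool (\<not> y r))"
    proof (cases "\<forall>r\<in>R. \<not> y r")
      case True
      then have "zero_on R y = y" by (auto simp: zero_on_def)
      with True rs show ?thesis by simp
    next
      case False
      then have "(\<Prod>r\<in>set rs. of_bool (\<not> y r)) = (0 :: complex)"
        using rs by (auto intro!: prod_zero)
      moreover have "\<psi> y = 0" using False supp R_def by blast
      ultimately show ?thesis by simp
    qed
  qed
  have z: "zero_on R (y(q := b)) = zero_on R y" if "q \<in> R" for y q b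
    using that by (auto simp: zero_on_def)
  have "run_circuit (hads rs) \<psi> =
     (\<lambda>y. \<psi> (zero_on R y) * (\<Prod>r\<in>set rs. \<Sum>b\<in>UNIV. had (y r) b * of_bool (\<not> b)))"
    by (subst \<psi>, rule run_hads_product) (use rs z in auto)
  also have "\<dots> = (\<lambda>y. \<psi> (zero_on R y) * (\<Prod>r\<in>set rs. had (y r) False))"
    by (simp add: UNIV_bool)
  finally have 1: "run_circuit (hads rs) \<psi> = (\<lambda>y. \<psi> (zero_on R y) * (\<Prod>r\<in>set rs. had (y r) False))" .
  have 2: "cis (diag_angle n L y) * (\<psi> (zero_on R y) * (\<Prod>r\<in>set rs. had (y r) False)) =
     \<psi> (zero_on R y) * (\<Prod>r\<in>set rs. cis (theta L y r * of_bool (y r)) * had (y r) False)" for y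
  proof (cases "\<psi> (zero_on R y) = 0")
    case False
    have "\<not> y q" if "q \<in> scratches n" for q
    proof -
      have "q \<notin> R" using that ok by (auto simp: level_ok_def R_def)
      then show ?thesis using supp False that by (auto simp: zero_on_def split: if_splits)
    qed
    then have "cis (diag_angle n L y) = (\<Prod>r\<in>R. cis (theta L y r * of_bool (y r)))"
      using L(1) by (simp add: diag_angle_eq[OF ok] R_def cis_sum del: sum_mult_of_bool_eq)
    then show ?thesis using rs by (simp add: prod.distrib mult_ac)
  qed simp
  have th: "theta L (y(q := b)) r = theta L y r" if "q \<in> R" for y q b r
    using L(4) that by (intro theta_cong) (auto simp: R_def)
  have "run_circuit (level_circuit n L) \<psi> = run_circuit (hads (rev rs))
     (\<lambda>y. \<psi> (zero_on R y) * (\<Prod>r\<in>set (rev rs). cis (theta L y r * of_bool (y r)) * had (y r) False))"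
    using 1 by (simp only: run_level_circuit[OF ok] rs_def[symmetric] R_def[symmetric] 2 set_rev)
  also have "\<dots> = (\<lambda>y. \<psi> (zero_on R y) * (\<Prod>r\<in>set (rev rs). \<Sum>b\<in>UNIV.
      had (y r) b * (cis (theta L y r * of_bool b) * had b False)))"
    by (rule run_hads_product) (use rs z th in \<open>simp_all del: fun_upd_apply\<close>)
  finally show ?thesis using rs R_def by simp
qed

text \<open>At an angle with \<open>cis\<close> equal to 1 or -1 one of the two amplitudes of the
  target vanishes, and a vanishing factor kills the whole product.\<close>

lemma run_level_support:
  assumes ok: "level_ok n L"
    and supp: "\<forall>x. \<psi> x \<noteq> 0 \<longrightarrow> (\<forall>q\<in>tgt L \<union> scratches n. \<not> x q)"
    and nz: "run_circuit (level_circuit n L) \<psi> x \<noteq> 0"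
  shows "\<psi> (zero_on (tgt L) x) \<noteq> 0" "level_sat L x"
proof -
  have P: "(\<Prod>r\<in>tgt L. \<Sum>b\<in>UNIV. had (x r) b * (cis (theta L x r * of_bool b) * had b False)) \<noteq> 0"
    and "\<psi> (zero_on (tgt L) x) \<noteq> 0"
    using nz run_level_product[OF ok supp] by auto
  then show "\<psi> (zero_on (tgt L) x) \<noteq> 0" by simp
  show "level_sat L x"
    unfolding level_sat_def
  proof (intro ballI)
    fix r assume r: "r \<in> tgt L"
    have "(\<Sum>b\<in>UNIV. had (x r) b * (cis (theta L x r * of_bool b) * had b False)) \<noteq> 0"
      using P r level_okD(1)[OF ok] by (metis (no_types, lifting) prod_zero)
    moreover have "(\<Sum>b\<in>UNIV. had (x r) b * (cis (theta L x r * of_bool b) * had b False))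
      = had (x r) True * had True False * cis (theta L x r) + had (x r) False * had False False"
      by (simp add: UNIV_bool mult_ac)
    ultimately show "(cis (theta L x r) = 1 \<longrightarrow> \<not> x r) \<and> (cis (theta L x r) = - 1 \<longrightarrow> x r)"
      by (cases "x r") (auto simp: had_mult)
  qed
qed

definition prepare :: "nat \<Rightarrow> level list \<Rightarrow> gate list" where
  "prepare n Ls = concat (map (level_circuit n) Ls)"

definition unprepare :: "nat \<Rightarrow> level list \<Rightarrow> gate list" where
  "unprepare n Ls = concat (map (level_circuit n \<circ> neg_level) (rev Ls))"

text \<open>A later level may read earlier targets but writes to no earlier target or control, so
  relations established by earlier levels persist.\<close>

definition levels_ok :: "nat \<Rightarrow> level list \<Rightarrow> bool" where
  "levels_ok n Ls \<longleftrightarrow> (\<forall>L\<in>set Ls. level_ok n L) \<and>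
     sorted_wrt (\<lambda>L L'. tgt L' \<inter> (tgt L \<union> Range (edg L)) = {}) Ls"

lemma run_unprepare:
  "(\<And>L. L \<in> set Ls \<Longrightarrow> level_ok n L) \<Longrightarrow> run_circuit (unprepare n Ls) (run_circuit (prepare n Ls) \<psi>) = \<psi>"
proof (induction Ls arbitrary: \<psi>)
  case (Cons L Ls)
  then show ?case
    by (simp add: prepare_def unprepare_def run_neg_level)
qed (simp add: prepare_def unprepare_def)

text \<open>Clearing the targets of the last level leads to a configuration in the support of the
  preceding state. Earlier levels do not see these targets, so their relations transfer back to
  \<open>x\<close>.\<close>

lemma run_prepare_support:
  assumes "levels_ok n Ls"
    and "\<forall>q\<in>scratches n \<union> (\<Union>L\<in>set Ls. tgt L). \<not> b q"
    and "run_circuit (prepare n Ls) (basis b) x \<noteq> 0"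
  shows "(\<forall>q. q \<notin> (\<Union>L\<in>set Ls. tgt L) \<longrightarrow> x q = b q) \<and> (\<forall>L\<in>set Ls. level_sat L x)"
  using assms
proof (induction Ls arbitrary: x rule: rev_induct)
  case Nil
  then show ?case by (auto simp: prepare_def basis_def split: if_splits)
next
  case (snoc L Ls)
  define \<psi> where "\<psi> = run_circuit (prepare n Ls) (basis b)"
  have ok: "level_ok n L" "levels_ok n Ls"
    and disj: "\<And>L'. L' \<in> set Ls \<Longrightarrow> tgt L \<inter> (tgt L' \<union> Range (edg L')) = {}"
    using snoc.prems(1) by (auto simp: levels_ok_def sorted_wrt_append)
  have IH: "(\<forall>q. q \<notin> (\<Union>L\<in>set Ls. tgt L) \<longrightarrow> y q = b q) \<and> (\<forall>L\<in>set Ls. level_sat L y)"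
    if "\<psi> y \<noteq> 0" for y
    using snoc.IH[OF ok(2)] snoc.prems(2) that by (auto simp: \<psi>_def)
  have scr: "q \<notin> (\<Union>L\<in>set Ls. tgt L)" if "q \<in> tgt L \<union> scratches n" for q
  proof
    assume "q \<in> (\<Union>L\<in>set Ls. tgt L)"
    then obtain L' where L': "L' \<in> set Ls" "q \<in> tgt L'" by blast
    then have "level_ok n L'" using ok(2) by (simp add: levels_ok_def)
    then show False using L' disj[OF L'(1)] that unfolding level_ok_def by blast
  qed
  have supp: "\<not> y q" if "\<psi> y \<noteq> 0" "q \<in> tgt L \<union> scratches n" for y q
    using IH[OF that(1)] scr[OF that(2)] snoc.prems(2) that(2) by auto
  have "run_circuit (level_circuit n L) \<psi> x \<noteq> 0"
    using snoc.prems(3) by (simp add: prepare_def \<psi>_def)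
  from run_level_support[OF ok(1) _ this] supp
  have nz: "\<psi> (zero_on (tgt L) x) \<noteq> 0" and sat: "level_sat L x" by auto
  have "level_sat L' x" if L': "L' \<in> set Ls" for L'
  proof -
    have "zero_on (tgt L) x r = x r" if "r \<in> tgt L' \<union> Range (edg L')" for r
      using disj[OF L'] that by (auto simp: zero_on_def)
    moreover from this have "theta L' (zero_on (tgt L) x) r = theta L' x r" for r
      by (intro theta_cong) auto
    moreover have "level_sat L' (zero_on (tgt L) x)" using IH[OF nz] L' by simp
    ultimately show ?thesis by (simp add: level_sat_def)
  qed
  moreover have "x q = b q" if "q \<notin> (\<Union>L\<in>set (Ls @ [L]). tgt L)" for q
    using IH[OF nz] that by (auto simp: zero_on_def split: if_splits)
  ultimately show ?case using sat by auto
qed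

section \<open>Acting on the output qubit between preparation and its inverse\<close>

definition flip :: "nat \<Rightarrow> config \<Rightarrow> config" where
  "flip z x = x(z := \<not> x z)"

text \<open>A gate that avoids \<open>z\<close> treats both values of \<open>z\<close> alike; this
  lets a flip of the output survive the inverse of the preparation.\<close>

lemma apply_gate_flip:
  assumes "z \<notin> gate_qubits g"
  shows "apply_gate g (\<lambda>x. \<psi> (flip z x)) = (\<lambda>x. apply_gate g \<psi> (flip z x))"
proof (cases g)
  case (OneQ q U)
  then have "flip z (x(q := b)) = (flip z x)(q := b)" for x b
    using assms by (auto simp: flip_def fun_upd_twist)
  then show ?thesis using OneQ assms by (simp add: flip_def)
next
  case (CNOT c t)
  then have "flip z (x(t := (x t \<noteq> x c))) = (flip z x)(t := (flip z x t \<noteq> flip z x c))" for x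
    using assms by (auto simp: flip_def fun_upd_twist)
  then show ?thesis using CNOT by simp
next
  case (FanOut c T)
  then have "flip z (\<lambda>i. if i \<in> set T then (x i \<noteq> x c) else x i)
      = (\<lambda>i. if i \<in> set T then (flip z x i \<noteq> flip z x c) else flip z x i)" for x
    using assms by (auto simp: flip_def fun_eq_iff)
  then show ?thesis using FanOut by simp
qed

lemma run_circuit_flip:
  "(\<And>g. g \<in> set gs \<Longrightarrow> z \<notin> gate_qubits g) \<Longrightarrow>
   run_circuit gs (\<lambda>x. \<psi> (flip z x)) = (\<lambda>x. run_circuit gs \<psi> (flip z x))"
  by (induction gs arbitrary: \<psi>) (simp_all add: apply_gate_flip del: apply_gate.simps)

lemma level_circuit_qubits:
  assumes "level_ok n L" "g \<in> set (level_circuit n L)"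
  shows "gate_qubits g \<subseteq> tgt L \<union> Range (edg L) \<union> scratches n"
proof -
  note L = level_okD[OF assms(1)]
  have "q \<in> scratches n" if "q \<in> edge_qubits n L" for q
    using that by (auto simp: in_edge_qubits scratches_def)
  moreover have "q \<in> scratches n" if "q \<in> set (fan_src n L u)" for q u
    using that by (auto simp: set_fan_src[OF assms(1)] scratches_def)
  moreover have "q \<in> scratches n" if "q \<in> set (fan_dst n L u)" for q u
    using that by (auto simp: set_fan_dst[OF assms(1)] scratches_def)
  moreover have "finite (edge_qubits n L)" using L by (simp add: edge_qubits_def)
  ultimately show ?thesis
    using assms(2) L(1,2)
    by (auto simp: level_circuit_inner[OF assms(1)] hads_def fans_def phases_def
        finite_Domain finite_Range dest: L(3))
qed

text \<open>Conjugating diag(1, s) by Hadamard gates yields the identity for s = 1 and a NOT for s =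
  -1. Unlike other targets, \<open>z\<close> may hold any value, and one \<open>f\<close> must be
  valid on the whole support of \<open>\<phi>\<close>.\<close>

lemma run_target_level:
  assumes ok: "level_ok n F" and tgt: "tgt F = {z}"
    and supp: "\<And>x q. \<phi> x \<noteq> 0 \<Longrightarrow> q \<in> scratches n \<Longrightarrow> \<not> x q"
    and th: "\<And>x. \<phi> x \<noteq> 0 \<Longrightarrow> cis (theta F x z) = (if f then - 1 else 1)"
  shows "run_circuit (level_circuit n F) \<phi> = (\<lambda>x. \<phi> (if f then flip z x else x))"
proof
  fix x
  have z: "z \<notin> scratches n" using ok tgt by (auto simp: level_ok_def)
  have theta: "theta F (y(z := b)) z = theta F y z" for y b
    using level_okD(4)[OF ok] tgt by (intro theta_cong) auto
  define s where "s = (if f then - 1 else 1 :: complex)"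
  have l: "list_of {z} = [z]" by (simp add: list_of_def)
  have expand: "run_circuit (level_circuit n F) \<phi> x
     = (\<Sum>b\<in>UNIV. had (x z) b * (cis (diag_angle n F (x(z := b))) * (\<Sum>c\<in>UNIV. had b c * \<phi> (x(z := c)))))"
    by (simp add: run_level_circuit[OF ok] tgt l hads_def)
  have triv: "\<phi> (x(z := x z)) = \<phi> x" by simp
  show "run_circuit (level_circuit n F) \<phi> x = \<phi> (if f then flip z x else x)"
  \<comment> \<open>\<open>th\<close> speaks only about the support. If neither value of
    \<open>z\<close> lies in it, both sides are 0; otherwise the angle can be read off at either
    value, since it does not depend on \<open>z\<close>.\<close>
  proof (cases "\<phi> (x(z := True)) = 0 \<and> \<phi> (x(z := False)) = 0")
    case True
    then have "\<phi> (x(z := c)) = 0" for c by (cases c) auto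
    moreover from this[of "x z"] have "\<phi> x = 0" by simp
    ultimately show ?thesis unfolding expand by (simp add: flip_def)
  next
    case False
    then obtain c where c: "\<phi> (x(z := c)) \<noteq> 0" by blast
    have "\<not> (x(z := b)) q" if "q \<in> scratches n" for b q
      using supp[OF c that] z that by (auto split: if_splits)
    then have "diag_angle n F (x(z := b)) = theta F x z * of_bool b" for b
      using diag_angle_eq[OF ok, of "x(z := b)"] by (simp add: tgt theta)
    moreover have "cis (theta F x z) = s"
      using th[OF c] by (simp add: theta s_def)
    ultimately have "cis (diag_angle n F (x(z := b))) = (if b then s else 1)" for b by simp
    then have "run_circuit (level_circuit n F) \<phi> x =
       (had (x z) False * had False True + s * (had (x z) True * had True True)) * \<phi> (x(z := True))
     + (had (x z) False * had False False + s * (had (x z) True * had True False)) * \<phi> (x(z := False))"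
      unfolding expand by (simp add: UNIV_bool algebra_simps)
    then show ?thesis
      using triv by (cases "x z"; cases f) (simp_all add: had_mult s_def flip_def)
  qed
qed

text \<open>The prepared state may be entangled, yet the output level merely composes it with one
  fixed flip or with nothing; the inverse preparation then returns to a basis state.\<close>

lemma run_compute:
  assumes ok: "levels_ok n Ls" "level_ok n F" and tgt: "tgt F = {z}"
    and z: "\<And>L. L \<in> set Ls \<Longrightarrow> z \<notin> tgt L \<union> Range (edg L)"
    and b: "\<forall>q\<in>scratches n \<union> (\<Union>L\<in>set Ls. tgt L). \<not> b q"
    and th: "\<And>x. (\<And>q. q \<notin> (\<Union>L\<in>set Ls. tgt L) \<Longrightarrow> x q = b q) \<Longrightarrow> (\<And>L. L \<in> set Ls \<Longrightarrow> level_sat L x)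
       \<Longrightarrow> cis (theta F x z) = (if f then - 1 else 1)"
  shows "run_circuit (prepare n Ls @ level_circuit n F @ unprepare n Ls) (basis b)
       = basis (b(z := (b z \<noteq> f)))"
proof -
  define \<phi> where "\<phi> = run_circuit (prepare n Ls) (basis b)"
  have oks: "level_ok n L" if "L \<in> set Ls" for L using ok(1) that by (simp add: levels_ok_def)
  have supp: "(\<forall>q. q \<notin> (\<Union>L\<in>set Ls. tgt L) \<longrightarrow> x q = b q) \<and> (\<forall>L\<in>set Ls. level_sat L x)"
    if "\<phi> x \<noteq> 0" for x
    using run_prepare_support[OF ok(1) b, of x] that by (simp add: \<phi>_def)
  have "tgt L \<inter> scratches n = {}" if "L \<in> set Ls" for L
    using oks[OF that] by (simp add: level_ok_def)
  then have scr: "q \<notin> (\<Union>L\<in>set Ls. tgt L)" if "q \<in> scratches n" for q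
    using that by blast
  have F: "run_circuit (level_circuit n F) \<phi> = (\<lambda>x. \<phi> (if f then flip z x else x))"
  proof (rule run_target_level[OF ok(2) tgt])
    fix x assume x: "\<phi> x \<noteq> 0"
    show "\<not> x q" if "q \<in> scratches n" for q
      using supp[OF x] scr[OF that] b that by auto
    show "cis (theta F x z) = (if f then - 1 else 1)"
      using supp[OF x] by (intro th) auto
  qed
  have "z \<notin> scratches n" using ok(2) tgt by (auto simp: level_ok_def)
  then have nz: "z \<notin> gate_qubits g" if "g \<in> set (unprepare n Ls)" for g
  proof -
    obtain L where L: "L \<in> set Ls" "g \<in> set (level_circuit n (neg_level L))"
      using \<open>g \<in> set (unprepare n Ls)\<close> by (auto simp: unprepare_def)
    then have "gate_qubits g \<subseteq> tgt L \<union> Range (edg L) \<union> scratches n"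
      using level_circuit_qubits[OF level_ok_neg[OF oks[OF L(1)]] L(2)] by simp
    then show ?thesis using z[OF L(1)] \<open>z \<notin> scratches n\<close> by blast
  qed
  have un: "run_circuit (unprepare n Ls) \<phi> = basis b"
    using run_unprepare oks by (simp add: \<phi>_def)
  show ?thesis
  proof (cases f)
    case True
    have "run_circuit (prepare n Ls @ level_circuit n F @ unprepare n Ls) (basis b)
      = (\<lambda>x. basis b (flip z x))"
      using F un run_circuit_flip[of "unprepare n Ls" z \<phi>] nz True by (simp add: \<phi>_def)
    also have "\<dots> = basis (b(z := \<not> b z))"
      by (auto simp: basis_def flip_def fun_eq_iff)
    finally show ?thesis using True by simp
  next
    case False
    then show ?thesis using F un by (simp add: \<phi>_def)
  qed
qed

section \<open>Resources and the order of levels\<close>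

lemma sorted_wrt_distinct:
  assumes "distinct xs" "\<And>x y. x \<in> set xs \<Longrightarrow> y \<in> set xs \<Longrightarrow> x \<noteq> y \<Longrightarrow> P x y"
  shows "sorted_wrt P xs"
  using assms by (induction xs) auto

lemma parallel_hads: "distinct qs \<Longrightarrow> parallel (hads qs)"
  by (simp add: parallel_def hads_def sorted_wrt_map sorted_wrt_distinct)

lemma parallel_phases: "distinct qs \<Longrightarrow> parallel (phases \<phi> qs)"
  by (simp add: parallel_def phases_def sorted_wrt_map sorted_wrt_distinct)

lemma parallel_fans:
  assumes "distinct qs"
    and "\<And>q i. q \<in> set qs \<Longrightarrow> i \<in> set (T q) \<Longrightarrow> src i = q"
    and "\<And>q q'. q \<in> set qs \<Longrightarrow> q' \<in> set qs \<Longrightarrow> q \<notin> set (T q')"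
  shows "parallel (fans T qs)"
  unfolding parallel_def fans_def sorted_wrt_map
proof (rule sorted_wrt_distinct[OF assms(1)])
  fix q r assume qr: "q \<in> set qs" "r \<in> set qs" "q \<noteq> r"
  have "set (T q) \<inter> set (T r) = {}"
    using assms(2)[OF qr(1)] assms(2)[OF qr(2)] qr(3) by blast
  then show "gate_qubits (FanOut q (T q)) \<inter> gate_qubits (FanOut r (T r)) = {}"
    using qr(3) assms(3)[OF qr(1,2)] assms(3)[OF qr(2,1)] by simp
qed

lemma level_layers_parallel:
  assumes ok: "level_ok n L" and l: "l \<in> set (level_layers n L)"
  shows "parallel l"
proof -
  note L = level_okD[OF ok]
  have "parallel (fans (fan_src n L) (list_of (Domain (edg L))))"
    by (rule parallel_fans[where src="fst \<circ> scratch_src n"])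
       (use L in \<open>auto simp: set_fan_src[OF ok] finite_Domain\<close>)
  moreover have "parallel (fans (fan_dst n L) (list_of (Range (edg L))))"
    by (rule parallel_fans[where src="snd \<circ> scratch_src n"])
       (use L in \<open>auto simp: set_fan_dst[OF ok] finite_Range\<close>)
  moreover have "finite (edge_qubits n L)" using L by (simp add: edge_qubits_def)
  ultimately show ?thesis
    using l L(1,2) by (auto simp: level_layers_def Let_def parallel_hads parallel_phases finite_Range)
qed

lemma length_level_layers: "length (level_layers n L) = 9"
  by (simp add: level_layers_def Let_def)

lemma level_circuit_wf:
  assumes ok: "level_ok n L" and g: "g \<in> set (level_circuit n L)"
  shows "wf_gate g"
proof -
  note L = level_okD[OF ok]
  have "wf_gate (FanOut u (fan_src n L u))" if "u \<in> Domain (edg L)" for u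
  proof -
    have "set (fan_src n L u) \<noteq> {}" using that by (auto simp: set_fan_src[OF ok])
    moreover have "distinct (fan_src n L u)"
      using L by (auto simp: fan_src_def distinct_map inj_on_def)
    moreover have "u \<notin> set (fan_src n L u)"
    proof
      assume "u \<in> set (fan_src n L u)"
      then obtain v where "u = scratch n u v" by (auto simp: fan_src_def)
      with that L(7)[of u v] show False by auto
    qed
    ultimately show ?thesis by auto
  qed
  moreover have "wf_gate (FanOut v (fan_dst n L v))" if "v \<in> Range (edg L)" for v
  proof -
    have "set (fan_dst n L v) \<noteq> {}" using that by (auto simp: set_fan_dst[OF ok])
    moreover have "distinct (fan_dst n L v)"
      using L by (auto simp: fan_dst_def distinct_map inj_on_def)
    moreover have "v \<notin> set (fan_dst n L v)"
    proof
      assume "v \<in> set (fan_dst n L v)"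
      then obtain u where "v = scratch n u v" by (auto simp: fan_dst_def)
      with that L(6)[of _ u v] show False by auto
    qed
    ultimately show ?thesis by auto
  qed
  ultimately show ?thesis
    using g L(2) unfolding level_circuit_inner[OF ok] hads_def fans_def phases_def
    by (auto simp: unitary2_had unitary2_phase finite_Domain finite_Range simp del: wf_gate.simps(3))
qed

lemma size_hads: "circuit_size (hads qs) = length qs"
  by (simp add: circuit_size_def hads_def o_def sum_list_triv)

lemma size_phases: "circuit_size (phases \<phi> qs) = length qs"
  by (simp add: circuit_size_def phases_def o_def sum_list_triv)

lemma size_fans:
  "distinct qs \<Longrightarrow> circuit_size (fans T qs) = (\<Sum>q\<in>set qs. length (T q)) + length qs"
  by (simp add: circuit_size_def fans_def o_def sum_list_distinct_conv_sum_set sum_Suc distinct_card)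

text \<open>Each of the four fan-out layers costs the number of edges plus the number of its control
  qubits, at most twice the edges; the two phase layers on edge qubits and controls cost at most the
  edges each. This gives the 10; targets are met only three times.\<close>

lemma size_level_circuit:
  assumes ok: "level_ok n L"
  shows "circuit_size (level_circuit n L) \<le> 10 * (card (tgt L) + card (edg L))"
proof -
  note L = level_okD[OF ok]
  have E1: "edg L = Sigma (Domain (edg L)) (\<lambda>u. edg L `` {u})" by auto
  have "(\<Sum>u\<in>Domain (edg L). length (fan_src n L u)) = (\<Sum>u\<in>Domain (edg L). card (edg L `` {u}))"
    using L by (simp add: fan_src_def)
  also have "\<dots> = card (Sigma (Domain (edg L)) (\<lambda>u. edg L `` {u}))"
    by (rule card_SigmaI[symmetric]) (use L in \<open>auto simp: finite_Domain\<close>)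
  also have "\<dots> = card (edg L)" by (simp add: E1[symmetric])
  finally have src: "(\<Sum>u\<in>Domain (edg L). length (fan_src n L u)) = card (edg L)" .
  have E2: "(edg L)\<inverse> = Sigma (Range (edg L)) (\<lambda>v. (edg L)\<inverse> `` {v})" by auto
  have "(\<Sum>v\<in>Range (edg L). length (fan_dst n L v)) = (\<Sum>v\<in>Range (edg L). card ((edg L)\<inverse> `` {v}))"
    using L by (simp add: fan_dst_def)
  also have "\<dots> = card (Sigma (Range (edg L)) (\<lambda>v. (edg L)\<inverse> `` {v}))"
    by (rule card_SigmaI[symmetric]) (use L in \<open>auto simp: finite_Range\<close>)
  also have "\<dots> = card (edg L)" by (simp add: E2[symmetric])
  finally have dst: "(\<Sum>v\<in>Range (edg L). length (fan_dst n L v)) = card (edg L)" .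
  have "card (fst ` edg L) \<le> card (edg L)" "card (snd ` edg L) \<le> card (edg L)"
    using L(2) by (simp_all add: card_image_le)
  then have "card (Domain (edg L)) \<le> card (edg L)" "card (Range (edg L)) \<le> card (edg L)"
    by (simp_all add: Domain_fst Range_snd)
  moreover have "card (edge_qubits n L) \<le> card (edg L)" "finite (edge_qubits n L)"
    using L(2) by (simp_all add: edge_qubits_def card_image_le)
  ultimately show ?thesis
    using src dst L(1,2)
    by (simp add: level_circuit_inner[OF ok] size_hads size_phases size_fans finite_Domain finite_Range)
qed

lemma circuit_depth_compute:
  assumes "\<And>L. L \<in> set (F # Ls) \<Longrightarrow> level_ok n L"
  shows "circuit_depth (prepare n Ls @ level_circuit n F @ unprepare n Ls) \<le> 9 * (2 * length Ls + 1)"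
proof -
  define ls where "ls = concat (map (level_layers n) (Ls @ [F] @ map neg_level (rev Ls)))"
  have len: "length (concat (map (level_layers n) xs)) = 9 * length xs" for xs
    by (induction xs) (simp_all add: length_level_layers)
  have cc: "concat (concat (map (level_layers n) xs)) = concat (map (level_circuit n) xs)" for xs
    by (induction xs) (simp_all add: level_circuit_def)
  have "parallel l" if "l \<in> set ls" for l
  proof -
    obtain L where "L \<in> set (Ls @ [F] @ map neg_level (rev Ls))" "l \<in> set (level_layers n L)"
      using \<open>l \<in> set ls\<close> by (auto simp: ls_def)
    moreover from this(1) assms have "level_ok n L" by (auto simp: level_ok_neg)
    ultimately show ?thesis by (simp add: level_layers_parallel)
  qed
  then have "circuit_depth (concat ls) \<le> length ls" by (rule circuit_depth_concat)
  then show ?thesis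
    unfolding ls_def cc len by (simp add: prepare_def unprepare_def)
qed

lemma wf_compute:
  assumes "\<And>L. L \<in> set (F # Ls) \<Longrightarrow> level_ok n L"
    and "g \<in> set (prepare n Ls @ level_circuit n F @ unprepare n Ls)"
  shows "wf_gate g"
proof -
  obtain L where "L \<in> set (F # Ls)" "g \<in> set (level_circuit n L) \<or> g \<in> set (level_circuit n (neg_level L))"
    using assms(2) by (auto simp: prepare_def unprepare_def)
  then show ?thesis using assms(1) level_circuit_wf level_ok_neg by blast
qed

definition level_size :: "level \<Rightarrow> nat" where
  "level_size L = card (tgt L) + card (edg L)"

lemma size_compute:
  assumes "\<And>L. L \<in> set (F # Ls) \<Longrightarrow> level_ok n L"
  shows "circuit_size (prepare n Ls @ level_circuit n F @ unprepare n Ls)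
      \<le> 10 * (2 * (\<Sum>L\<leftarrow>Ls. level_size L) + level_size F)"
proof -
  have one: "circuit_size (level_circuit n L) \<le> 10 * level_size L"
    "circuit_size (level_circuit n (neg_level L)) \<le> 10 * level_size L" if "L \<in> set (F # Ls)" for L
    using size_level_circuit[OF assms[OF that]] size_level_circuit[OF level_ok_neg[OF assms[OF that]]]
    by (simp_all add: level_size_def)
  have cat: "circuit_size (concat (map f xs)) \<le> 10 * (\<Sum>L\<leftarrow>xs. level_size L)"
    if "\<And>L. L \<in> set xs \<Longrightarrow> circuit_size (f L) \<le> 10 * level_size L" for f xs
    using that
  proof (induction xs)
    case (Cons L xs)
    from Cons.IH Cons.prems have "circuit_size (concat (map f xs)) \<le> 10 * (\<Sum>L\<leftarrow>xs. level_size L)"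
      by (meson list.set_intros(2))
    then show ?case using Cons.prems[of L] by simp
  qed simp
  have "circuit_size (prepare n Ls) \<le> 10 * (\<Sum>L\<leftarrow>Ls. level_size L)"
    unfolding prepare_def by (rule cat) (simp add: one)
  moreover have "circuit_size (unprepare n Ls) \<le> 10 * (\<Sum>L\<leftarrow>Ls. level_size L)"
    using cat[of "rev Ls" "level_circuit n \<circ> neg_level"] one(2)
    by (simp add: unprepare_def rev_map[symmetric])
  ultimately show ?thesis using one(1)[of F] by simp
qed

text \<open>The first two entries of an ancilla name are the counting round and the level within it.\<close>
definition ranked :: "nat \<Rightarrow> nat \<Rightarrow> level \<Rightarrow> bool" where
  "ranked n r L \<longleftrightarrow> finite (tgt L) \<and> finite (edg L) \<and> Domain (edg L) \<subseteq> tgt L \<and>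
     (\<forall>q\<in>tgt L. \<exists>xs. q = anc n xs \<and> 4 * xs ! 0 + xs ! 1 = r) \<and>
     (\<forall>v\<in>Range (edg L). v < n \<or> (\<exists>xs. v = anc n xs \<and> 4 * xs ! 0 + xs ! 1 < r))"

lemma ranked_tgt:
  assumes "ranked n r L" "q \<in> tgt L"
  shows "n < q" "q \<notin> scratches n" "4 * anc_index n q ! 0 + anc_index n q ! 1 = r"
  using assms by (auto simp: ranked_def scratches_def)

lemma ranked_Range:
  assumes "ranked n r L" "v \<in> Range (edg L)"
  shows "v \<noteq> n" "v \<notin> scratches n"
    "v < n \<or> 4 * anc_index n v ! 0 + anc_index n v ! 1 < r"
proof -
  have *: "v < n \<or> (\<exists>xs. v = anc n xs \<and> 4 * xs ! 0 + xs ! 1 < r)"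
    using assms by (simp add: ranked_def)
  then show "v \<noteq> n" "v < n \<or> 4 * anc_index n v ! 0 + anc_index n v ! 1 < r" by auto
  show "v \<notin> scratches n"
  proof
    assume "v \<in> scratches n"
    then obtain a b where "v = scratch n a b" by (auto simp: scratches_def)
    with * scratch_gt(1)[of n a b] show False by auto
  qed
qed

lemma level_ok_ranked:
  assumes "ranked n r L"
  shows "level_ok n L"
proof -
  have "v \<notin> tgt L" if "v \<in> Range (edg L)" for v
    using ranked_Range(3)[OF assms that] ranked_tgt(1,3)[OF assms, of v] by auto
  then show ?thesis
    using ranked_tgt(2)[OF assms] ranked_Range(2)[OF assms] assms
    unfolding level_ok_def ranked_def by blast
qed

text \<open>The rank of an ancilla can be read off its name, so targets of a higher rank differ from
  all targets and controls of a lower level.\<close>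

lemma levels_ok_ranked:
  assumes "list_all2 (ranked n) rs Ls" "sorted_wrt (<) rs"
  shows "levels_ok n Ls"
  using assms
proof (induction rule: list_all2_induct)
  case (Cons r rs L Ls)
  have "tgt L' \<inter> (tgt L \<union> Range (edg L)) = {}" if L': "L' \<in> set Ls" for L'
  proof -
    obtain r' where r': "r' \<in> set rs" "ranked n r' L'"
      using Cons.hyps(2) L' by (metis in_set_conv_nth list_all2_conv_all_nth)
    then have "r < r'" using Cons.prems by simp
    have "q \<notin> tgt L \<union> Range (edg L)" if q: "q \<in> tgt L'" for q
      using ranked_tgt(1,3)[OF r'(2) q] ranked_tgt(3)[OF Cons.hyps(1), of q]
        ranked_Range(3)[OF Cons.hyps(1), of q] \<open>r < r'\<close> by auto
    then show ?thesis by blast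
  qed
  moreover have "levels_ok n Ls" using Cons by simp
  ultimately show ?case
    using level_ok_ranked[OF Cons.hyps(1)] by (simp add: levels_ok_def)
qed (simp add: levels_ok_def)

section \<open>Comparing a weighted sum with constants\<close>

lemma cis_nat_pi: "cis (real k * pi) = (if even k then 1 else - 1)"
  by (induction k) (auto simp: distrib_right simp flip: cis_mult)

lemma cis_int_pi: "cis (of_int k * pi) = (if even k then 1 else - 1)"
proof (cases "k \<ge> 0")
  case True
  then show ?thesis using cis_nat_pi[of "nat k"] by (simp add: even_nat_iff)
next
  case False
  have "cis (of_int k * pi) = inverse (cis (of_int (- k) * pi))"
    by simp
  also have "cis (of_int (- k) * pi) = (if even k then 1 else - 1)"
    using False cis_nat_pi[of "nat (- k)"] by (simp add: even_nat_iff del: of_int_minus)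
  finally show ?thesis by simp
qed

text \<open>If \<open>d = 2\<^sup>a \<cdot> odd\<close>, the rotation by \<open>\<pi> / 2\<^sup>a\<close> detects that \<open>d\<close> is nonzero with certainty.\<close>
lemma exists_cis_minus_one:
  fixes d :: int
  assumes "d \<noteq> 0" "\<bar>d\<bar> < 2 ^ m"
  shows "\<exists>a<m. cis (of_int d * (pi / 2 ^ a)) = - 1"
  using assms
proof (induction m arbitrary: d)
  case (Suc m)
  show ?case
  proof (cases "even d")
    case True
    then obtain e where e: "d = 2 * e" by blast
    then have "e \<noteq> 0" "\<bar>e\<bar> < 2 ^ m" using Suc.prems by auto
    from Suc.IH[OF this] obtain a where a: "a < m" "cis (of_int e * (pi / 2 ^ a)) = - 1" by blast
    have "of_int d * (pi / 2 ^ Suc a) = of_int e * (pi / 2 ^ a)" by (simp add: e)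
    then show ?thesis using a by (metis Suc_mono)
  next
    case False
    then have "cis (of_int d * (pi / 2 ^ 0)) = - 1" by (simp add: cis_int_pi)
    then show ?thesis by blast
  qed
qed auto

text \<open>Toggling the membership of one true bit \<open>b\<close> is an involution on the subsets
  that flips the parity, so exactly half of them are odd. An OR is thus the sum of all parities
  divided by 2^(m-1), a linear form that phases can accumulate.\<close>

lemma sum_parities:
  assumes "\<exists>b<m. y b"
  shows "(\<Sum>S\<in>Pow {..<m}. of_bool (odd (card {b\<in>S. y b}))) = (2 ^ (m - 1) :: real)"
proof -
  obtain b where b: "b < m" "y b" using assms by blast
  define tog where "tog S = (if b \<in> S then S - {b} else insert b S)" for S
  define p :: "nat set \<Rightarrow> real" where "p S = of_bool (odd (card {b\<in>S. y b}))" for S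
  have tog: "tog (tog S) = S" for S by (auto simp: tog_def)
  have tog_Pow: "tog S \<in> Pow {..<m}" if "S \<in> Pow {..<m}" for S
    using that b by (auto simp: tog_def)
  have p: "p (tog S) = 1 - p S" if S: "S \<in> Pow {..<m}" for S
  proof -
    have fin: "finite {c\<in>T. y c}" if "T \<subseteq> S" for T
      using that S finite_subset[of T "{..<m}"] by auto
    show ?thesis
    proof (cases "b \<in> S")
      case True
      then have "{c\<in>S. y c} = insert b {c\<in>tog S. y c}" "b \<notin> {c\<in>tog S. y c}"
        using b by (auto simp: tog_def)
      moreover have "finite {c\<in>tog S. y c}" using True by (intro fin) (auto simp: tog_def)
      ultimately show ?thesis by (simp add: p_def)
    next
      case False
      then have "{c\<in>tog S. y c} = insert b {c\<in>S. y c}" "b \<notin> {c\<in>S. y c}"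
        using b by (auto simp: tog_def)
      moreover have "finite {c\<in>S. y c}" by (intro fin) simp
      ultimately show ?thesis by (simp add: p_def)
    qed
  qed
  have "(\<Sum>S\<in>Pow {..<m}. p S) = (\<Sum>S\<in>Pow {..<m}. p (tog S))"
    by (rule sum.reindex_bij_witness[of _ tog tog]) (use tog tog_Pow in auto)
  also have "\<dots> = (\<Sum>S\<in>Pow {..<m}. 1 - p S)" by (intro sum.cong refl p)
  also have "\<dots> = 2 ^ m - (\<Sum>S\<in>Pow {..<m}. p S)" by (simp add: sum_subtractf card_Pow)
  finally have "2 * (\<Sum>S\<in>Pow {..<m}. p S) = 2 ^ m" by simp
  moreover have "(2 :: real) ^ m = 2 * 2 ^ (m - 1)" using b(1) by (cases m) auto
  ultimately show ?thesis by (simp add: p_def)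
qed

text \<open>One round \<open>l\<close> of counting: each group g in \<open>G\<close> has the inputs
  \<open>I g\<close> with weights \<open>w\<close>, and its weighted sum is compared with each
  constant in \<open>K\<close> by \<open>m\<close> rotations, later reduced to \<open>m2\<close>
  bits. Inputs are register qubits or ancillas of earlier rounds; \<open>m2\<close> leaves room for
  a count of up to \<open>m\<close> set bits.\<close>

locale counter =
  fixes n l :: nat and G :: "nat set" and I :: "nat \<Rightarrow> nat set" and w :: "nat \<Rightarrow> nat"
    and K :: "nat set" and m m2 :: nat
  assumes finG: "finite G" and finK: "finite K" and finI: "g \<in> G \<Longrightarrow> finite (I g)"
    and inputs: "g \<in> G \<Longrightarrow> v \<in> I g \<Longrightarrow> v < n \<or> (\<exists>xs. v = anc n xs \<and> 4 * xs ! 0 + xs ! 1 < 4 * l)"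
    and m2: "m < 2 ^ m2"
begin

definition rot :: "nat \<Rightarrow> nat \<Rightarrow> nat \<Rightarrow> nat" where "rot g k a = anc n [l, 0, g, k, a]"

definition red :: "nat \<Rightarrow> nat \<Rightarrow> nat \<Rightarrow> nat" where "red g k b = anc n [l, 1, g, k, b]"

text \<open>Ancilla names are lists of numbers, hence the code of the subset; it is injective on
  finite sets.\<close>

definition par :: "nat \<Rightarrow> nat \<Rightarrow> nat set \<Rightarrow> nat" where "par g k S = anc n [l, 2, g, k, set_encode S]"

definition rot_level :: level where
  "rot_level = Level ((\<lambda>(g, k, a). rot g k a) ` (G \<times> K \<times> {..<m}))
     ((\<lambda>(g, k, a, v). (rot g k a, v)) ` (SIGMA g:G. K \<times> {..<m} \<times> I g))
     (\<lambda>u v. real (w v) * (pi / 2 ^ (anc_index n u ! 4)))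
     (\<lambda>u. - real (anc_index n u ! 3) * (pi / 2 ^ (anc_index n u ! 4)))"

definition red_level :: level where
  "red_level = Level ((\<lambda>(g, k, b). red g k b) ` (G \<times> K \<times> {..<m2}))
     ((\<lambda>(g, k, b, a). (red g k b, rot g k a)) ` (G \<times> K \<times> {..<m2} \<times> {..<m}))
     (\<lambda>u v. pi / 2 ^ (anc_index n u ! 4)) (\<lambda>u. 0)"

definition par_level :: level where
  "par_level = Level ((\<lambda>(g, k, S). par g k S) ` (G \<times> K \<times> Pow {..<m2}))
     ((\<lambda>(g, k, S, b). (par g k S, red g k b)) ` (G \<times> K \<times> (SIGMA S:Pow {..<m2}. S)))
     (\<lambda>u v. pi) (\<lambda>u. 0)"

text \<open>Summed over \<open>S\<close>, the parities of one comparison contribute -pi on a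
  mismatch and 0 on a match. With pi times the number of selected constants as offset
  \<open>c\<close>, only a match remains. \<open>out\<close> is a parameter because the last round
  writes to qubit \<open>n\<close> itself.\<close>

definition out_level :: "(nat \<Rightarrow> nat \<Rightarrow> nat) \<Rightarrow> nat \<Rightarrow> (nat \<Rightarrow> nat \<Rightarrow> bool) \<Rightarrow> (nat \<Rightarrow> real) \<Rightarrow> level" where
  "out_level out b f c = Level ((\<lambda>(g, i). out g i) ` (G \<times> {..<b}))
     ((\<lambda>(g, i, k, S). (out g i, par g k S)) ` (G \<times> (SIGMA i:{..<b}. {k\<in>K. f i k} \<times> Pow {..<m2})))
     (\<lambda>u v. - pi / 2 ^ (m2 - 1)) c"

lemma par_eq: "S \<subseteq> {..<m2} \<Longrightarrow> T \<subseteq> {..<m2} \<Longrightarrow> par g k S = par g' k' T \<longleftrightarrow> g = g' \<and> k = k' \<and> S = T"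
  using set_encode_eq[of S T] finite_subset[of _ "{..<m2}"] by (auto simp: par_def)

lemma ranked_rot: "ranked n (4 * l) rot_level"
  unfolding ranked_def
proof (intro conjI ballI)
  show "finite (tgt rot_level)" using finG finK by (simp add: rot_level_def)
  show "finite (edg rot_level)" using finG finK finI by (simp add: rot_level_def)
  show "Domain (edg rot_level) \<subseteq> tgt rot_level" by (force simp: rot_level_def)
next
  fix q assume "q \<in> tgt rot_level"
  then obtain g k a where "q = anc n [l, 0, g, k, a]" by (auto simp: rot_level_def rot_def)
  then show "\<exists>xs. q = anc n xs \<and> 4 * xs ! 0 + xs ! 1 = 4 * l" by force
next
  fix v assume "v \<in> Range (edg rot_level)"
  then show "v < n \<or> (\<exists>xs. v = anc n xs \<and> 4 * xs ! 0 + xs ! 1 < 4 * l)"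
    using inputs by (auto simp: rot_level_def)
qed

lemma ranked_red: "ranked n (4 * l + 1) red_level"
  unfolding ranked_def
proof (intro conjI ballI)
  show "finite (tgt red_level)" using finG finK by (simp add: red_level_def)
  show "finite (edg red_level)" using finG finK by (simp add: red_level_def)
  show "Domain (edg red_level) \<subseteq> tgt red_level" by (force simp: red_level_def)
next
  fix q assume "q \<in> tgt red_level"
  then obtain g k a where "q = anc n [l, 1, g, k, a]" by (auto simp: red_level_def red_def)
  then show "\<exists>xs. q = anc n xs \<and> 4 * xs ! 0 + xs ! 1 = 4 * l + 1" by force
next
  fix v assume "v \<in> Range (edg red_level)"
  then obtain g k a where "v = anc n [l, 0, g, k, a]" by (auto simp: red_level_def rot_def)
  then show "v < n \<or> (\<exists>xs. v = anc n xs \<and> 4 * xs ! 0 + xs ! 1 < 4 * l + 1)" by force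
qed

lemma ranked_par: "ranked n (4 * l + 2) par_level"
  unfolding ranked_def
proof (intro conjI ballI)
  have "finite S" if "S \<in> Pow {..<m2}" for S using that finite_subset by auto
  then have "finite (SIGMA S:Pow {..<m2}. S)" by (intro finite_SigmaI) auto
  then show "finite (tgt par_level)" "finite (edg par_level)"
    using finG finK by (auto simp: par_level_def)
  show "Domain (edg par_level) \<subseteq> tgt par_level" by (force simp: par_level_def)
next
  fix q assume "q \<in> tgt par_level"
  then obtain g k a where "q = anc n [l, 2, g, k, a]" by (auto simp: par_level_def par_def)
  then show "\<exists>xs. q = anc n xs \<and> 4 * xs ! 0 + xs ! 1 = 4 * l + 2" by force
next
  fix v assume "v \<in> Range (edg par_level)"
  then obtain g k a where "v = anc n [l, 1, g, k, a]" by (auto simp: par_level_def red_def)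
  then show "v < n \<or> (\<exists>xs. v = anc n xs \<and> 4 * xs ! 0 + xs ! 1 < 4 * l + 2)" by force
qed

lemma out_level_Range:
  assumes "v \<in> Range (edg (out_level out b f c))"
  shows "\<exists>xs. v = anc n xs \<and> 4 * xs ! 0 + xs ! 1 = 4 * l + 2"
proof -
  from assms obtain g k a where "v = anc n [l, 2, g, k, a]" by (auto simp: out_level_def par_def)
  then show ?thesis by force
qed

lemma finite_out_level: "finite (tgt (out_level out b f c))" "finite (edg (out_level out b f c))"
  using finG finK by (auto simp: out_level_def)

lemma Domain_out_level: "Domain (edg (out_level out b f c)) \<subseteq> tgt (out_level out b f c)"
  by (force simp: out_level_def)

lemma ranked_out: "ranked n (4 * l + 3) (out_level (\<lambda>g i. anc n [l, 3, g, i]) b f c)"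
  unfolding ranked_def
proof (intro conjI ballI finite_out_level Domain_out_level)
  fix q assume "q \<in> tgt (out_level (\<lambda>g i. anc n [l, 3, g, i]) b f c)"
  then obtain g i where "q = anc n [l, 3, g, i]" by (auto simp: out_level_def)
  then show "\<exists>xs. q = anc n xs \<and> 4 * xs ! 0 + xs ! 1 = 4 * l + 3" by force
next
  fix v assume "v \<in> Range (edg (out_level (\<lambda>g i. anc n [l, 3, g, i]) b f c))"
  from out_level_Range[OF this]
  show "v < n \<or> (\<exists>xs. v = anc n xs \<and> 4 * xs ! 0 + xs ! 1 < 4 * l + 3)" by force
qed

definition total :: "config \<Rightarrow> nat \<Rightarrow> nat" where
  "total x g = (\<Sum>v\<in>I g. w v * of_bool (x v))"

text \<open>On equality all angles vanish and every bit is surely 0; otherwise the power of two in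
  the difference singles out a bit that is surely 1. The undetermined bits cannot change the
  OR.\<close>

lemma rot_sat:
  assumes sat: "level_sat rot_level x" and g: "g \<in> G" "k \<in> K"
    and small: "total x g < 2 ^ m" "k < 2 ^ m"
  shows "(\<exists>a<m. x (rot g k a)) \<longleftrightarrow> total x g \<noteq> k"
proof -
  have theta: "theta rot_level x (rot g k a) = of_int (int (total x g) - int k) * (pi / 2 ^ a)" if "a < m" for a
  proof -
    have "edg rot_level `` {rot g k a} = I g"
      using g that by (force simp: rot_level_def rot_def)
    then have "theta rot_level x (rot g k a)
        = - real k * (pi / 2 ^ a) + (\<Sum>v\<in>I g. real (w v) * (pi / 2 ^ a) * of_bool (x v))"
      unfolding theta_def by (simp add: rot_level_def rot_def del: sum_mult_of_bool_eq)
    also have "(\<Sum>v\<in>I g. real (w v) * (pi / 2 ^ a) * of_bool (x v)) = real (total x g) * (pi / 2 ^ a)"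
      unfolding total_def of_nat_sum sum_distrib_right by (intro sum.cong refl) simp
    finally show ?thesis by (simp add: algebra_simps)
  qed
  have sat': "(cis (theta rot_level x (rot g k a)) = 1 \<longrightarrow> \<not> x (rot g k a)) \<and>
     (cis (theta rot_level x (rot g k a)) = - 1 \<longrightarrow> x (rot g k a))" if "a < m" for a
    using sat g that by (force simp: level_sat_def rot_level_def)
  show ?thesis
  proof (cases "total x g = k")
    case True
    then have "\<not> x (rot g k a)" if "a < m" for a
      using sat'[OF that] theta[OF that] by simp
    with True show ?thesis by blast
  next
    case False
    have "int (total x g) < int (2 ^ m)" "int k < int (2 ^ m)"
      using small by (simp_all only: of_nat_less_iff)
    then have "\<bar>int (total x g) - int k\<bar> < int (2 ^ m)" by linarith
    then have "\<bar>int (total x g) - int k\<bar> < 2 ^ m" by simp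
    then obtain a where a: "a < m" "cis (of_int (int (total x g) - int k) * (pi / 2 ^ a)) = - 1"
      using exists_cis_minus_one[of "int (total x g) - int k" m] False by auto
    then have "x (rot g k a)" using sat'[OF a(1)] theta[OF a(1)] by simp
    with a False show ?thesis by blast
  qed
qed

text \<open>The same test applied to the number \<open>c\<close> of set rotation bits, compared with
  0. \<open>c\<close> may vary over the superposition; only whether it is 0 matters.\<close>

lemma red_sat:
  assumes sat: "level_sat red_level x" and g: "g \<in> G" "k \<in> K"
  shows "(\<exists>b<m2. x (red g k b)) \<longleftrightarrow> (\<exists>a<m. x (rot g k a))"
proof -
  define c where "c = card {a. a < m \<and> x (rot g k a)}"
  have theta: "theta red_level x (red g k b) = of_int (int c) * (pi / 2 ^ b)" if "b < m2" for b
  proof -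
    have "edg red_level `` {red g k b} = rot g k ` {..<m}"
      using g that by (force simp: red_level_def red_def)
    then have "theta red_level x (red g k b) = (\<Sum>v\<in>rot g k ` {..<m}. pi / 2 ^ b * of_bool (x v))"
      unfolding theta_def by (simp add: red_level_def red_def del: sum_mult_of_bool_eq)
    also have "\<dots> = (\<Sum>a<m. pi / 2 ^ b * of_bool (x (rot g k a)))"
      by (subst sum.reindex) (auto simp: inj_on_def rot_def simp del: sum_mult_of_bool_eq)
    also have "\<dots> = (\<Sum>a<m. of_bool (x (rot g k a))) * (pi / 2 ^ b)"
      unfolding sum_distrib_right by (intro sum.cong refl) simp
    also have "(\<Sum>a<m. of_bool (x (rot g k a))) = real c"
      by (simp add: c_def lessThan_def Collect_conj_eq)
    finally show ?thesis by simp
  qed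
  have sat': "(cis (theta red_level x (red g k b)) = 1 \<longrightarrow> \<not> x (red g k b)) \<and>
     (cis (theta red_level x (red g k b)) = - 1 \<longrightarrow> x (red g k b))" if "b < m2" for b
    using sat g that by (force simp: level_sat_def red_level_def)
  show ?thesis
  proof (cases "\<exists>a<m. x (rot g k a)")
    case False
    then have "c = 0" by (simp add: c_def)
    then have "\<not> x (red g k b)" if "b < m2" for b
      using sat'[OF that] theta[OF that] by simp
    with False show ?thesis by blast
  next
    case True
    then have "c \<noteq> 0" by (auto simp: c_def)
    have "c \<le> card {..<m}" unfolding c_def by (intro card_mono) auto
    then have "c < 2 ^ m2" using m2 by simp
    then have "int c < int (2 ^ m2)" by (simp only: of_nat_less_iff)
    then have "\<bar>int c\<bar> < 2 ^ m2" by simp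
    then obtain b where b: "b < m2" "cis (of_int (int c) * (pi / 2 ^ b)) = - 1"
      using exists_cis_minus_one[of "int c" m2] \<open>c \<noteq> 0\<close> by auto
    then have "x (red g k b)" using sat'[OF b(1)] theta[OF b(1)] by simp
    with b True show ?thesis by blast
  qed
qed

text \<open>All angles are multiples of pi here, so each parity qubit is fixed by the reduced bits
  of the same configuration and \<open>sum_parities\<close> applies.\<close>

lemma par_sat:
  assumes sat: "level_sat par_level x" and g: "g \<in> G" "k \<in> K"
  shows "(\<Sum>S\<in>Pow {..<m2}. of_bool (x (par g k S)))
     = (if \<exists>b<m2. x (red g k b) then 2 ^ (m2 - 1) else 0 :: real)"
proof -
  have "x (par g k S) \<longleftrightarrow> odd (card {b\<in>S. x (red g k b)})" if S: "S \<in> Pow {..<m2}" for S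
  proof -
    have fin: "finite S" using S finite_subset by auto
    have "edg par_level `` {par g k S} = red g k ` S"
      using g S by (force simp: par_level_def par_eq)
    then have "theta par_level x (par g k S) = (\<Sum>v\<in>red g k ` S. pi * of_bool (x v))"
      unfolding theta_def by (simp add: par_level_def del: sum_mult_of_bool_eq)
    also have "\<dots> = (\<Sum>b\<in>S. pi * of_bool (x (red g k b)))"
      by (subst sum.reindex) (auto simp: inj_on_def red_def simp del: sum_mult_of_bool_eq)
    also have "\<dots> = (\<Sum>b\<in>S. of_bool (x (red g k b))) * pi"
      unfolding sum_distrib_right by (intro sum.cong refl) simp
    also have "(\<Sum>b\<in>S. of_bool (x (red g k b))) = real (card {b\<in>S. x (red g k b)})"
      using fin by (simp add: Collect_conj_eq)
    finally have "cis (theta par_level x (par g k S))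
        = (if even (card {b\<in>S. x (red g k b)}) then 1 else - 1)"
      by (simp add: cis_nat_pi)
    moreover have "par g k S \<in> tgt par_level"
      using g S by (force simp: par_level_def)
    ultimately show ?thesis
      using sat by (auto simp: level_sat_def split: if_splits)
  qed
  then have *: "(\<Sum>S\<in>Pow {..<m2}. of_bool (x (par g k S)))
     = (\<Sum>S\<in>Pow {..<m2}. of_bool (odd (card {b\<in>S. x (red g k b)})) :: real)"
    by (intro sum.cong) auto
  show ?thesis
  proof (cases "\<exists>b<m2. x (red g k b)")
    case True
    then show ?thesis using * sum_parities[of m2 "\<lambda>b. x (red g k b)"] by simp
  next
    case False
    then have none: "{b\<in>S. x (red g k b)} = {}" if "S \<in> Pow {..<m2}" for S
      using that by auto
    have "(\<Sum>S\<in>Pow {..<m2}. of_bool (odd (card {b\<in>S. x (red g k b)})) :: real) = 0"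
      by (intro sum.neutral ballI) (simp add: none)
    with False * show ?thesis by simp
  qed
qed

text \<open>Here the undetermined bits drop out: apart from the offset, the angle depends on the
  configuration only through \<open>total\<close>. \<open>inj\<close> ensures that the edges at
  \<open>out g i\<close> come from this pair alone.\<close>

lemma out_theta:
  assumes sat: "level_sat rot_level x" "level_sat red_level x" "level_sat par_level x"
    and g: "g \<in> G" "i < b"
    and inj: "\<And>g' i'. g' \<in> G \<Longrightarrow> i' < b \<Longrightarrow> out g' i' = out g i \<Longrightarrow> g' = g \<and> i' = i"
    and small: "total x g < 2 ^ m" "\<And>k. k \<in> K \<Longrightarrow> k < 2 ^ m"
  shows "theta (out_level out b f c) x (out g i)
     = c (out g i) - pi * real (card {k\<in>K. f i k \<and> k \<noteq> total x g})"
proof -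
  define Ki where "Ki = {k\<in>K. f i k}"
  have finKi: "finite Ki" using finK by (simp add: Ki_def)
  have "edg (out_level out b f c) `` {out g i} = (\<lambda>(k, S). par g k S) ` (Ki \<times> Pow {..<m2})"
  proof (intro equalityI subsetI)
    fix v assume "v \<in> edg (out_level out b f c) `` {out g i}"
    then obtain g' i' k S where *: "g' \<in> G" "i' < b" "k \<in> K" "f i' k" "S \<subseteq> {..<m2}"
      "out g' i' = out g i" "v = par g' k S"
      by (auto simp: out_level_def)
    then show "v \<in> (\<lambda>(k, S). par g k S) ` (Ki \<times> Pow {..<m2})"
      using inj[OF *(1,2,6)] by (auto simp: Ki_def)
  next
    fix v assume "v \<in> (\<lambda>(k, S). par g k S) ` (Ki \<times> Pow {..<m2})"
    then obtain k S where "k \<in> K" "f i k" "S \<subseteq> {..<m2}" "v = par g k S" by (auto simp: Ki_def)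
    then have "(out g i, v) \<in> edg (out_level out b f c)"
      using g unfolding out_level_def by (auto intro!: image_eqI[where x="(g, i, k, S)"])
    then show "v \<in> edg (out_level out b f c) `` {out g i}" by simp
  qed
  moreover have "inj_on (\<lambda>(k, S). par g k S) (Ki \<times> Pow {..<m2})"
    by (auto simp: inj_on_def par_eq)
  ultimately have "theta (out_level out b f c) x (out g i)
      = c (out g i) + (\<Sum>(k, S)\<in>Ki \<times> Pow {..<m2}. - pi / 2 ^ (m2 - 1) * of_bool (x (par g k S)))"
    unfolding theta_def
    by (simp add: sum.reindex out_level_def case_prod_unfold o_def del: sum_mult_of_bool_eq)
  also have "(\<Sum>(k, S)\<in>Ki \<times> Pow {..<m2}. - pi / 2 ^ (m2 - 1) * of_bool (x (par g k S)))
      = (\<Sum>k\<in>Ki. - pi / 2 ^ (m2 - 1) * (\<Sum>S\<in>Pow {..<m2}. of_bool (x (par g k S))))"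
    by (simp add: sum.cartesian_product[symmetric] sum_distrib_left del: sum_mult_of_bool_eq sum_of_bool_eq)
  also have "\<dots> = (\<Sum>k\<in>Ki. - pi * of_bool (k \<noteq> total x g))"
  proof (intro sum.cong refl)
    fix k assume "k \<in> Ki"
    then have k: "k \<in> K" by (simp add: Ki_def)
    have "(\<exists>b<m2. x (red g k b)) \<longleftrightarrow> k \<noteq> total x g"
      using red_sat[OF sat(2) g(1) k] rot_sat[OF sat(1) g(1) k small(1) small(2)[OF k]] by auto
    then show "- pi / 2 ^ (m2 - 1) * (\<Sum>S\<in>Pow {..<m2}. of_bool (x (par g k S)))
       = - pi * of_bool (k \<noteq> total x g)"
      unfolding par_sat[OF sat(3) g(1) k] by simp
  qed
  also have "\<dots> = - pi * (\<Sum>k\<in>Ki. of_bool (k \<noteq> total x g))"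
    by (simp add: sum_distrib_left del: sum_mult_of_bool_eq sum_of_bool_eq)
  also have "(\<Sum>k\<in>Ki. of_bool (k \<noteq> total x g)) = real (card {k\<in>K. f i k \<and> k \<noteq> total x g})"
    using finKi by (simp add: Ki_def Collect_conj_eq Int_assoc)
  finally show ?thesis by simp
qed

lemma card_split:
  "real (card {k\<in>K. P k}) - real (card {k\<in>K. P k \<and> k \<noteq> s}) = of_bool (s \<in> K \<and> P s)"
proof (cases "s \<in> K \<and> P s")
  case True
  then have "{k\<in>K. P k} = insert s {k\<in>K. P k \<and> k \<noteq> s}" by auto
  then show ?thesis using True finK by simp
next
  case False
  then have "{k\<in>K. P k} = {k\<in>K. P k \<and> k \<noteq> s}" by auto
  then show ?thesis using False by simp
qed

end

context counter
begin

text \<open>The offset turns the angle into pi times the indicator of a match, so the digit qubits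
  are certain and can serve as weighted inputs of the next round.\<close>

lemma out_bits_sat:
  assumes sat: "level_sat rot_level x" "level_sat red_level x" "level_sat par_level x"
    and out: "level_sat (out_level (\<lambda>g i. anc n [l, 3, g, i]) b f
       (\<lambda>u. pi * real (card {k\<in>K. f (anc_index n u ! 3) k}))) x"
    and g: "g \<in> G" "i < b"
    and small: "total x g < 2 ^ m" "\<And>k. k \<in> K \<Longrightarrow> k < 2 ^ m"
  shows "x (anc n [l, 3, g, i]) \<longleftrightarrow> total x g \<in> K \<and> f i (total x g)"
proof -
  let ?c = "\<lambda>u. pi * real (card {k\<in>K. f (anc_index n u ! 3) k})"
  let ?L = "out_level (\<lambda>g i. anc n [l, 3, g, i]) b f ?c"
  have "theta ?L x (anc n [l, 3, g, i])
      = ?c (anc n [l, 3, g, i]) - pi * real (card {k\<in>K. f i k \<and> k \<noteq> total x g})"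
    by (rule out_theta[OF sat g _ small]) auto
  also have "\<dots> = pi * of_bool (total x g \<in> K \<and> f i (total x g))"
    by (simp add: card_split[symmetric] right_diff_distrib)
  finally have "cis (theta ?L x (anc n [l, 3, g, i])) = (if total x g \<in> K \<and> f i (total x g) then - 1 else 1)"
    by simp
  moreover have "anc n [l, 3, g, i] \<in> tgt ?L"
    using g by (force simp: out_level_def)
  ultimately show ?thesis
    using out by (auto simp: level_sat_def split: if_splits)
qed

text \<open>\<open>c\<close> bounds the fan-in of the rotations. Since 2^m2 <= 2 m, a comparison
  needs only linearly many parities in \<open>m\<close>; apart from the rotation edges at most 5 N m
  + 5 N m^2 remains, hence the 10.\<close>

lemma counter_size:
  assumes c: "\<And>g. g \<in> G \<Longrightarrow> card (I g) \<le> c" and m: "1 \<le> m" "b \<le> m" and m2': "2 ^ m2 \<le> 2 * m" "m2 \<le> m"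
    and K: "K \<noteq> {}"
  shows "level_size rot_level + level_size red_level + level_size par_level + level_size (out_level out b f off')
     \<le> card G * card K * m * (c + 10 * m)"
proof -
  define N where "N = card G * card K"
  have "card (tgt rot_level) \<le> card (G \<times> K \<times> {..<m})"
    unfolding rot_level_def level.sel using finG finK by (intro card_image_le) auto
  moreover have "card (edg rot_level) \<le> card (SIGMA g:G. K \<times> {..<m} \<times> I g)"
    unfolding rot_level_def level.sel using finG finK finI by (intro card_image_le) auto
  moreover have "card (SIGMA g:G. K \<times> {..<m} \<times> I g) = (\<Sum>g\<in>G. card K * (m * card (I g)))"
    using finG finK finI by (subst card_SigmaI) (auto simp: card_cartesian_product)
  moreover have "\<dots> \<le> (\<Sum>g\<in>G. card K * (m * c))"
    by (intro sum_mono mult_le_mono le_refl c)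
  ultimately have 1: "level_size rot_level \<le> N * m + N * m * c"
    by (simp add: level_size_def N_def card_cartesian_product mult.assoc)
  have "card (tgt red_level) \<le> card (G \<times> K \<times> {..<m2})"
    unfolding red_level_def level.sel using finG finK by (intro card_image_le) auto
  moreover have "card (edg red_level) \<le> card (G \<times> K \<times> {..<m2} \<times> {..<m})"
    unfolding red_level_def level.sel using finG finK by (intro card_image_le) auto
  ultimately have 2: "level_size red_level \<le> N * m2 + N * m2 * m"
    by (simp add: level_size_def N_def card_cartesian_product mult.assoc)
  have finS: "finite S" "card S \<le> m2" if "S \<in> Pow {..<m2}" for S
    using that finite_subset[of S "{..<m2}"] card_mono[of "{..<m2}" S] by auto
  then have finSig: "finite (SIGMA S:Pow {..<m2}. S)" by (intro finite_SigmaI) auto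
  have "card (SIGMA S:Pow {..<m2}. S) = (\<Sum>S\<in>Pow {..<m2}. card S)"
    using finS by (intro card_SigmaI) auto
  also have "\<dots> \<le> (\<Sum>S\<in>Pow {..<m2}. m2)" using finS by (intro sum_mono) auto
  finally have Sig: "card (SIGMA S:Pow {..<m2}. S) \<le> 2 ^ m2 * m2" by (simp add: card_Pow)
  have "card (tgt par_level) \<le> card (G \<times> K \<times> Pow {..<m2})"
    unfolding par_level_def level.sel using finG finK by (intro card_image_le) auto
  moreover have "card (edg par_level) \<le> card (G \<times> K \<times> (SIGMA S:Pow {..<m2}. S))"
    unfolding par_level_def level.sel using finG finK finSig
    by (intro card_image_le finite_cartesian_product)
  moreover have "card (G \<times> K \<times> (SIGMA S:Pow {..<m2}. S)) \<le> N * (2 ^ m2 * m2)"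
    unfolding card_cartesian_product N_def mult.assoc by (intro mult_le_mono le_refl Sig)
  ultimately have "card (tgt par_level) \<le> N * 2 ^ m2" "card (edg par_level) \<le> N * (2 ^ m2 * m2)"
    by (simp_all only: card_cartesian_product N_def card_Pow mult.assoc finite_lessThan card_lessThan)
  then have 3: "level_size par_level \<le> N * 2 ^ m2 + N * (2 ^ m2 * m2)"
    by (simp add: level_size_def)
  have "card (tgt (out_level out b f off')) \<le> card (G \<times> {..<b})"
    unfolding out_level_def level.sel using finG by (intro card_image_le) auto
  moreover have "card (edg (out_level out b f off')) \<le> card (G \<times> (SIGMA i:{..<b}. {k\<in>K. f i k} \<times> Pow {..<m2}))"
    unfolding out_level_def level.sel using finG finK by (intro card_image_le) auto
  moreover have "card (G \<times> (SIGMA i:{..<b}. {k\<in>K. f i k} \<times> Pow {..<m2})) \<le> card (G \<times> {..<b} \<times> K \<times> Pow {..<m2})"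
    using finG finK by (intro card_mono) auto
  ultimately have "card (tgt (out_level out b f off')) \<le> card (G \<times> {..<b})"
    "card (edg (out_level out b f off')) \<le> card (G \<times> {..<b} \<times> K \<times> Pow {..<m2})"
    by (simp_all only: le_trans)
  then have 4: "level_size (out_level out b f off') \<le> card G * b + N * b * 2 ^ m2"
    by (simp add: level_size_def N_def card_cartesian_product card_Pow mult_ac)
  have "1 \<le> card K" using K finK by (simp add: Suc_le_eq card_gt_0_iff)
  then have "card G * b \<le> N * m"
    unfolding N_def using mult_le_mono[of "card G" "card G * card K" b m] m(2) by simp
  moreover have "N * m2 + N * m2 * m \<le> N * m + N * m * m"
    using m2'(2) by (intro add_mono mult_le_mono le_refl)
  moreover have "N * 2 ^ m2 + N * (2 ^ m2 * m2) \<le> N * (2 * m) + N * (2 * m * m)"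
    using m2' by (intro add_mono mult_le_mono le_refl)
  moreover have "N * b * 2 ^ m2 \<le> N * m * (2 * m)"
    using m2' m by (intro mult_le_mono le_refl)
  moreover have "N * m \<le> N * m * m" using m(1) by simp
  moreover have "N * (2 * m) = 2 * (N * m)" "N * (2 * m * m) = 2 * (N * m * m)"
    "N * m * (2 * m) = 2 * (N * m * m)"
    by simp_all
  ultimately have "level_size rot_level + level_size red_level + level_size par_level
      + level_size (out_level out b f off') \<le> N * m * c + 10 * (N * m * m)"
    using 1 2 3 4 by linarith
  then show ?thesis by (simp add: N_def algebra_simps)
qed

end

section \<open>Binary digits of counters, fibres and blocks\<close>

lemma sum_bits:
  assumes "s < 2 ^ b"
  shows "(\<Sum>i<b. 2 ^ i * of_bool (bit s i)) = (s :: nat)"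
proof -
  have "(\<Sum>i<b. 2 ^ i * of_bool (bit s i)) = take_bit b s"
    by (simp add: take_bit_sum push_bit_eq_mult mult.commute atLeast0LessThan del: sum_mult_of_bool_eq)
  then show ?thesis using assms by (simp add: take_bit_nat_eq_self)
qed

definition bit_qubits :: "nat \<Rightarrow> nat \<Rightarrow> nat set \<Rightarrow> nat \<Rightarrow> nat set" where
  "bit_qubits n l H b = (\<lambda>(g, i). anc n [l, 3, g, i]) ` (H \<times> {..<b})"

lemma bit_qubits_total:
  fixes s :: "nat \<Rightarrow> nat"
  assumes "\<And>g. g \<in> H \<Longrightarrow> s g < 2 ^ b"
    and "\<And>g i. g \<in> H \<Longrightarrow> i < b \<Longrightarrow> x (anc n [l, 3, g, i]) \<longleftrightarrow> bit (s g) i"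
  shows "(\<Sum>v\<in>bit_qubits n l H b. 2 ^ (anc_index n v ! 3) * of_bool (x v)) = (\<Sum>g\<in>H. s g)"
proof -
  have "(\<Sum>v\<in>bit_qubits n l H b. 2 ^ (anc_index n v ! 3) * of_bool (x v))
     = (\<Sum>(g, i)\<in>H \<times> {..<b}. 2 ^ i * of_bool (x (anc n [l, 3, g, i])) :: nat)"
    unfolding bit_qubits_def
    by (subst sum.reindex) (auto simp: inj_on_def case_prod_unfold simp del: sum_mult_of_bool_eq)
  also have "\<dots> = (\<Sum>g\<in>H. \<Sum>i<b. 2 ^ i * of_bool (x (anc n [l, 3, g, i])))"
    by (rule sum.cartesian_product[symmetric])
  also have "\<dots> = (\<Sum>g\<in>H. s g)"
  proof (intro sum.cong refl)
    fix g assume g: "g \<in> H"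
    have "(\<Sum>i<b. 2 ^ i * of_bool (x (anc n [l, 3, g, i]))) = (\<Sum>i<b. 2 ^ i * of_bool (bit (s g) i) :: nat)"
      using assms(2)[OF g] by (intro sum.cong) auto
    then show "(\<Sum>i<b. 2 ^ i * of_bool (x (anc n [l, 3, g, i]))) = s g"
      using sum_bits[OF assms(1)[OF g]] by simp
  qed
  finally show ?thesis .
qed

lemma card_by_fibres:
  assumes "finite A" "finite H" "\<And>v. v \<in> A \<Longrightarrow> \<phi> v \<in> H"
  shows "(\<Sum>h\<in>H. card {v\<in>A. \<phi> v = h}) = card A"
  using sum.group[OF assms(1,2), of \<phi> "\<lambda>_. 1 :: nat"] assms(3) by auto

definition block :: "nat \<Rightarrow> nat \<Rightarrow> nat \<Rightarrow> nat set" where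
  "block n B g = {v. v < n \<and> v div B = g}"

lemma finite_block [simp]: "finite (block n B g)"
  by (simp add: block_def)

lemma card_block:
  assumes "0 < B"
  shows "card (block n B g) \<le> B"
proof -
  have "block n B g \<subseteq> {g * B..<g * B + B}"
  proof
    fix v assume "v \<in> block n B g"
    then have "B * g + v mod B = v" using mult_div_mod_eq[of B v] by (simp add: block_def)
    moreover have "v mod B < B" using assms by simp
    ultimately show "v \<in> {g * B..<g * B + B}" by (simp add: mult.commute)
  qed
  from card_mono[OF _ this] show ?thesis by simp
qed

text \<open>\<open>k\<close> is the bit length of \<open>m\<close>: enough rotations to detect every
  nonzero count up to \<open>m\<close>, while 2^k parities stay linear in \<open>m\<close>.\<close>

lemma exists_log:
  assumes "1 \<le> (m :: nat)"
  shows "\<exists>k. m < 2 ^ k \<and> 2 ^ k \<le> 2 * m \<and> k \<le> m"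
proof -
  obtain k where k: "2 ^ k \<le> m" "m < 2 ^ (k + 1)"
    using ex_power_ivl1[of 2 m] assms by auto
  have "k < 2 ^ k" by (rule less_exp)
  with k have "k + 1 \<le> m" by linarith
  with k show ?thesis by (intro exI[of _ "k + 1"]) auto
qed

section \<open>Symmetric functions by block counting\<close>

lemma finite_bit_qubits [simp]: "finite H \<Longrightarrow> finite (bit_qubits n l H b)"
  by (simp add: bit_qubits_def)

lemma card_bit_qubits: "finite H \<Longrightarrow> card (bit_qubits n l H b) \<le> card H * b"
  unfolding bit_qubits_def using card_image_le[of "H \<times> {..<b}"] by simp

lemma bit_qubits_input:
  assumes "v \<in> bit_qubits n l H b" "4 * l + 3 < r"
  shows "\<exists>xs. v = anc n xs \<and> 4 * xs ! 0 + xs ! 1 < r"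
proof -
  obtain g i where "v = anc n [l, 3, g, i]" using assms(1) by (auto simp: bit_qubits_def)
  then show ?thesis using assms(2) by (intro exI[of _ "[l, 3, g, i]"]) simp
qed

text \<open>The three size summands are the rounds, with factors for groups, constants, rotations
  and fan-in. \<open>c\<close> negates the answer. The depth is 9 (2 * 11 + 1): nine layers for each
  of eleven levels, their inverses and the output level.\<close>

lemma symmetric_circuit:
  fixes n \<beta> :: nat and c :: bool
  assumes K: "K \<noteq> {}" "K \<subseteq> {..n}" and m: "n < 2 ^ m"
  shows "\<exists>gs. (\<forall>g\<in>set gs. wf_gate g) \<and>
     (\<forall>x z. run_circuit gs (basis (input_config n x z))
          = basis (input_config n x (z \<noteq> ((card {j. j < n \<and> x j} \<in> K) \<noteq> c)))) \<and>
     circuit_depth gs \<le> 207 \<and>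
     circuit_size gs \<le> 20 *
       ((n div 2 ^ \<beta> + 1) * (2 ^ \<beta> + 1) * (\<beta> + 1) * (2 ^ \<beta> + 10 * (\<beta> + 1))
      + (n div 4 ^ \<beta> + 1) * (4 ^ \<beta> + 1) * (2 * \<beta> + 1) * (2 ^ \<beta> * (\<beta> + 1) + 10 * (2 * \<beta> + 1))
      + card K * (m + 1) * ((n div 4 ^ \<beta> + 1) * (2 * \<beta> + 1) + 10 * (m + 1)))"
proof -
  define B :: nat where "B = 2 ^ \<beta>"
  \<comment> \<open>One digit more than \<beta>, because a full block has count \<open>B\<close>
    itself; likewise for \<open>M2\<close> and \<open>B * B\<close>.\<close>
  define M1 where "M1 = \<beta> + 1"
  define M2 where "M2 = 2 * \<beta> + 1"
  define M3 where "M3 = m + 1"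
  define u1 :: "nat \<Rightarrow> nat" where "u1 = (\<lambda>_. 1)"
  have B: "0 < B" "B < 2 ^ M1" by (simp_all add: B_def M1_def)
  have BB: "B * B = 4 ^ \<beta>" "B * B = 2 ^ (2 * \<beta>)"
    by (simp_all add: B_def power_mult_distrib[symmetric] power_mult)
  then have BB': "B * B < 2 ^ M2" "0 < B * B" using B by (simp_all add: M2_def)
  have M: "1 \<le> M1" "1 \<le> M2" "1 \<le> M3" by (simp_all add: M1_def M2_def M3_def)
  obtain p1 where p1: "M1 < 2 ^ p1" "2 ^ p1 \<le> 2 * M1" "p1 \<le> M1"
    using exists_log[OF M(1)] by blast
  obtain p2 where p2: "M2 < 2 ^ p2" "2 ^ p2 \<le> 2 * M2" "p2 \<le> M2"
    using exists_log[OF M(2)] by blast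
  obtain p3 where p3: "M3 < 2 ^ p3" "2 ^ p3 \<le> 2 * M3" "p3 \<le> M3"
    using exists_log[OF M(3)] by blast
  \<comment> \<open>The small blocks inside large block \<open>g\<close>; dividing by
    \<open>B\<close> twice is dividing by \<open>B * B\<close>.\<close>
  define H where "H g = {h. h \<le> n div B \<and> h div B = g}" for g
  have finH: "finite (H g)" for g by (simp add: H_def)
  have cardH: "card (H g) \<le> B" for g
  proof -
    have "H g = block (n div B + 1) B g" by (auto simp: H_def block_def)
    then show ?thesis using card_block[OF B(1)] by simp
  qed
  define w :: "nat \<Rightarrow> nat" where "w v = 2 ^ (anc_index n v ! 3)" for v
  have finK: "finite K" using K(2) finite_subset by blast

  interpret c1: counter n 0 "{..n div B}" "block n B" u1 "{..B}" M1 p1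
    by unfold_locales (use p1 in \<open>auto simp: block_def\<close>)
  interpret c2: counter n 1 "{..n div (B * B)}" "\<lambda>g. bit_qubits n 0 (H g) M1" w "{..B * B}" M2 p2
    by unfold_locales (use p2 finH bit_qubits_input[of _ n 0 _ _ "4 * 1"] in auto)
  interpret c3: counter n 2 "{0}" "\<lambda>_. bit_qubits n 1 {..n div (B * B)} M2" w K M3 p3
    by unfold_locales (use p3 finK bit_qubits_input[of _ n 1 _ _ "4 * 2"] in auto)

  define o1 where "o1 = c1.out_level (\<lambda>g i. anc n [0, 3, g, i]) M1 (\<lambda>i k. bit k i)
     (\<lambda>u. pi * real (card {k\<in>{..B}. bit k (anc_index n u ! 3)}))"
  define o2 where "o2 = c2.out_level (\<lambda>g i. anc n [1, 3, g, i]) M2 (\<lambda>i k. bit k i)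
     (\<lambda>u. pi * real (card {k\<in>{..B * B}. bit k (anc_index n u ! 3)}))"
  \<comment> \<open>This offset leaves the angle pi ([s in K] + [c]), where s is the weight; its
    \<open>cis\<close> is -1 exactly when one of the two holds.\<close>
  define F where "F = c3.out_level (\<lambda>_ _. n) 1 (\<lambda>_ _. True) (\<lambda>_. pi * (real (card K) + of_bool c))"
  define Ls where "Ls = [c1.rot_level, c1.red_level, c1.par_level, o1,
     c2.rot_level, c2.red_level, c2.par_level, o2, c3.rot_level, c3.red_level, c3.par_level]"
  have ranks: "list_all2 (ranked n) [0, 1, 2, 3, 4, 5, 6, 7, 8, 9, 10] Ls"
    using c1.ranked_rot c1.ranked_red c1.ranked_par c1.ranked_out
      c2.ranked_rot c2.ranked_red c2.ranked_par c2.ranked_out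
      c3.ranked_rot c3.ranked_red c3.ranked_par
    by (simp add: Ls_def o1_def o2_def del: add_2_eq_Suc add_2_eq_Suc')
  then have ok: "levels_ok n Ls" by (rule levels_ok_ranked) simp
  have tgtF: "tgt F = {n}" by (auto simp: F_def c3.out_level_def)
  have okF: "level_ok n F"
  proof -
    have "finite (tgt F)" "finite (edg F)" "Domain (edg F) \<subseteq> tgt F"
      unfolding F_def by (rule c3.finite_out_level c3.Domain_out_level)+
    moreover have "v \<notin> tgt F \<and> v \<notin> scratches n" if "v \<in> Range (edg F)" for v
      using c3.out_level_Range[OF that[unfolded F_def]] tgtF by (auto simp: scratches_def)
    moreover have "n \<notin> scratches n" by (auto simp: scratches_def)
    moreover from calculation(4) have "Range (edg F) \<inter> tgt F = {}" "Range (edg F) \<inter> scratches n = {}"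
      by blast+
    ultimately show ?thesis by (simp add: level_ok_def tgtF)
  qed
  have rk: "\<exists>r. ranked n r L" if "L \<in> set Ls" for L
    using ranks that by (metis in_set_conv_nth list_all2_conv_all_nth)
  have okL: "level_ok n L" if "L \<in> set (F # Ls)" for L
    using that okF ok by (auto simp: levels_ok_def)
  have nL: "n \<notin> tgt L \<union> Range (edg L)" if "L \<in> set Ls" for L
    using rk[OF that] ranked_tgt(1)[of n _ L n] ranked_Range(1)[of n _ L n] by auto

  define gs where "gs = prepare n Ls @ level_circuit n F @ unprepare n Ls"
  have run: "run_circuit gs (basis (input_config n x z))
      = basis (input_config n x (z \<noteq> ((card {j. j < n \<and> x j} \<in> K) \<noteq> c)))" for x z
  proof -
    define s where "s = card {j. j < n \<and> x j}"
    define f where "f = ((s \<in> K) \<noteq> c)"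
    have "run_circuit gs (basis (input_config n x z))
      = basis ((input_config n x z)(n := (input_config n x z n \<noteq> f)))"
      unfolding gs_def
    proof (rule run_compute[OF ok okF tgtF nL])
      show "\<forall>q\<in>scratches n \<union> (\<Union>L\<in>set Ls. tgt L). \<not> input_config n x z q"
      proof
        fix q assume "q \<in> scratches n \<union> (\<Union>L\<in>set Ls. tgt L)"
        then have "n < q" using rk ranked_tgt(1) by (fastforce simp: scratches_def)
        then show "\<not> input_config n x z q" by (simp add: input_config_def)
      qed
    next
      fix y assume eq: "\<And>q. q \<notin> (\<Union>L\<in>set Ls. tgt L) \<Longrightarrow> y q = input_config n x z q"
        and sat: "\<And>L. L \<in> set Ls \<Longrightarrow> level_sat L y"
      have y: "y j = x j" if "j < n" for j
      proof -
        have "j \<notin> (\<Union>L\<in>set Ls. tgt L)" using that rk ranked_tgt(1) by fastforce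
        then show ?thesis using eq that by (simp add: input_config_def)
      qed
      define A where "A = {j. j < n \<and> x j}"
      define s1 where "s1 g = card {v\<in>A. v div B = g}" for g
      define s2 where "s2 g = card {v\<in>A. v div (B * B) = g}" for g
      have finA: "finite A" by (simp add: A_def)
      have s1: "s1 g \<le> B" for g
        using card_mono[of "block n B g" "{v\<in>A. v div B = g}"] card_block[OF B(1), of n g]
        by (force simp: s1_def A_def block_def)
      have s2: "s2 g \<le> B * B" for g
        using card_mono[of "block n (B * B) g" "{v\<in>A. v div (B * B) = g}"] card_block[OF BB'(2), of n g]
        by (force simp: s2_def A_def block_def)
      have t1: "c1.total y g = s1 g" for g
      proof -
        have "c1.total y g = (\<Sum>v\<in>block n B g. of_bool (y v))"
          unfolding c1.total_def by (simp add: u1_def)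
        also have "\<dots> = card (block n B g \<inter> {v. y v})" by simp
        also have "block n B g \<inter> {v. y v} = {v\<in>A. v div B = g}" using y by (auto simp: block_def A_def)
        finally show ?thesis by (simp add: s1_def)
      qed
      have bits1: "y (anc n [0, 3, g, i]) \<longleftrightarrow> bit (s1 g) i" if "g \<le> n div B" "i < M1" for g i
      proof -
        have "y (anc n [0, 3, g, i]) \<longleftrightarrow> c1.total y g \<in> {..B} \<and> bit (c1.total y g) i"
        proof (rule c1.out_bits_sat)
          show "c1.total y g < 2 ^ M1" using s1[of g] B(2) by (simp only: t1)
          show "\<And>k. k \<in> {..B} \<Longrightarrow> k < 2 ^ M1" using B(2) by simp
        qed (use sat that in \<open>auto simp: Ls_def o1_def\<close>)
        then show ?thesis using s1 by (simp add: t1)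
      qed
      have t2: "c2.total y g = s2 g" for g
      proof -
        have "c2.total y g = (\<Sum>h\<in>H g. s1 h)"
          unfolding c2.total_def w_def
        proof (rule bit_qubits_total)
          show "s1 h < 2 ^ M1" for h using s1[of h] B(2) by linarith
          show "y (anc n [0, 3, h, i]) \<longleftrightarrow> bit (s1 h) i" if "h \<in> H g" "i < M1" for h i
            using that by (intro bits1) (auto simp: H_def)
        qed
        also have "\<dots> = (\<Sum>h\<in>H g. card {v\<in>{v\<in>A. v div (B * B) = g}. v div B = h})"
        proof (rule sum.cong[OF refl])
          fix h assume "h \<in> H g"
          then have "{v\<in>A. v div B = h} = {v\<in>{v\<in>A. v div (B * B) = g}. v div B = h}"
            by (auto simp: H_def div_mult2_eq)
          then show "s1 h = card {v\<in>{v\<in>A. v div (B * B) = g}. v div B = h}"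
            by (simp only: s1_def)
        qed
        also have "\<dots> = s2 g"
          unfolding s2_def
          by (rule card_by_fibres) (use finA in \<open>auto simp: H_def A_def div_mult2_eq intro: div_le_mono\<close>)
        finally show ?thesis .
      qed
      have bits2: "y (anc n [1, 3, g, i]) \<longleftrightarrow> bit (s2 g) i" if "g \<le> n div (B * B)" "i < M2" for g i
      proof -
        have "y (anc n [1, 3, g, i]) \<longleftrightarrow> c2.total y g \<in> {..B * B} \<and> bit (c2.total y g) i"
        proof (rule c2.out_bits_sat)
          show "c2.total y g < 2 ^ M2" using s2[of g] BB'(1) by (simp only: t2)
          show "\<And>k. k \<in> {..B * B} \<Longrightarrow> k < 2 ^ M2" using BB'(1) by simp
        qed (use sat that in \<open>auto simp: Ls_def o2_def\<close>)
        then show ?thesis using s2 by (simp add: t2)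
      qed
      have t3: "c3.total y 0 = s"
      proof -
        have "c3.total y 0 = (\<Sum>g\<in>{..n div (B * B)}. s2 g)"
          unfolding c3.total_def w_def
        proof (rule bit_qubits_total)
          show "s2 h < 2 ^ M2" for h using s2[of h] BB'(1) by linarith
        qed (use bits2 in auto)
        also have "\<dots> = s"
          unfolding s2_def s_def A_def[symmetric]
          by (rule card_by_fibres) (use finA in \<open>auto simp: A_def intro: div_le_mono\<close>)
        finally show ?thesis .
      qed
      have "s \<le> n" unfolding s_def using card_mono[of "{..<n}" "{j. j < n \<and> x j}"] by auto
      have "theta F y n = pi * (real (card K) + of_bool c) - pi * real (card {k\<in>K. True \<and> k \<noteq> c3.total y 0})"
        unfolding F_def
      proof (rule c3.out_theta)
        show "c3.total y 0 < 2 ^ M3" using \<open>s \<le> n\<close> m unfolding t3 M3_def by simp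
        show "\<And>k. k \<in> K \<Longrightarrow> k < 2 ^ M3" using K(2) m unfolding M3_def by fastforce
      qed (use sat in \<open>auto simp: Ls_def\<close>)
      also have "\<dots> = pi * (of_bool (s \<in> K) + of_bool c)"
        unfolding t3 using c3.card_split[of "\<lambda>_. True" s] by (simp add: algebra_simps flip: distrib_left)
      finally show "cis (theta F y n) = (if f then - 1 else 1)"
        using cis_nat_pi[of 2] by (auto simp: f_def mult.commute)
    qed
    also have "(input_config n x z)(n := (input_config n x z n \<noteq> f)) = input_config n x (z \<noteq> f)"
      by (auto simp: input_config_def fun_eq_iff)
    finally show ?thesis by (simp add: f_def s_def)
  qed
  have S1: "level_size c1.rot_level + level_size c1.red_level + level_size c1.par_level + level_size o1
     \<le> (n div B + 1) * (B + 1) * M1 * (B + 10 * M1)"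
  proof -
    have "level_size c1.rot_level + level_size c1.red_level + level_size c1.par_level + level_size o1
      \<le> card {..n div B} * card {..B} * M1 * (B + 10 * M1)"
      unfolding o1_def by (rule c1.counter_size) (use card_block[OF B(1)] p1 M in auto)
    then show ?thesis by simp
  qed
  have S2: "level_size c2.rot_level + level_size c2.red_level + level_size c2.par_level + level_size o2
     \<le> (n div (B * B) + 1) * (B * B + 1) * M2 * (B * M1 + 10 * M2)"
  proof -
    have "card (bit_qubits n 0 (H g) M1) \<le> B * M1" for g
      using card_bit_qubits[OF finH] cardH mult_le_mono1 order_trans by blast
    then have "level_size c2.rot_level + level_size c2.red_level + level_size c2.par_level + level_size o2
      \<le> card {..n div (B * B)} * card {..B * B} * M2 * (B * M1 + 10 * M2)"
      unfolding o2_def by (intro c2.counter_size) (use p2 M in auto)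
    then show ?thesis by simp
  qed
  have S3: "level_size c3.rot_level + level_size c3.red_level + level_size c3.par_level + level_size F
     \<le> card K * M3 * ((n div (B * B) + 1) * M2 + 10 * M3)"
  proof -
    have "card (bit_qubits n 1 {..n div (B * B)} M2) \<le> (n div (B * B) + 1) * M2"
      using card_bit_qubits[of "{..n div (B * B)}" n 1 M2] by simp
    then have "level_size c3.rot_level + level_size c3.red_level + level_size c3.par_level + level_size F
      \<le> card {0 :: nat} * card K * M3 * ((n div (B * B) + 1) * M2 + 10 * M3)"
      unfolding F_def by (intro c3.counter_size) (use p3 M K(1) in auto)
    then show ?thesis by simp
  qed
  have "circuit_size gs \<le> 10 * (2 * (\<Sum>L\<leftarrow>Ls. level_size L) + level_size F)"
    unfolding gs_def by (rule size_compute[OF okL])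
  also have "\<dots> \<le> 20 * ((\<Sum>L\<leftarrow>Ls. level_size L) + level_size F)" by simp
  also have "(\<Sum>L\<leftarrow>Ls. level_size L) + level_size F
      = level_size c1.rot_level + level_size c1.red_level + level_size c1.par_level + level_size o1
      + (level_size c2.rot_level + level_size c2.red_level + level_size c2.par_level + level_size o2)
      + (level_size c3.rot_level + level_size c3.red_level + level_size c3.par_level + level_size F)"
    by (simp only: Ls_def list.map sum_list.Cons sum_list.Nil add.assoc add_0_right add_0_left)
  also have "\<dots> \<le> (n div B + 1) * (B + 1) * M1 * (B + 10 * M1)
      + (n div (B * B) + 1) * (B * B + 1) * M2 * (B * M1 + 10 * M2)
      + card K * M3 * ((n div (B * B) + 1) * M2 + 10 * M3)"
    by (intro add_mono S1 S2 S3)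
  finally have size: "circuit_size gs \<le> 20 *
       ((n div 2 ^ \<beta> + 1) * (2 ^ \<beta> + 1) * (\<beta> + 1) * (2 ^ \<beta> + 10 * (\<beta> + 1))
      + (n div 4 ^ \<beta> + 1) * (4 ^ \<beta> + 1) * (2 * \<beta> + 1) * (2 ^ \<beta> * (\<beta> + 1) + 10 * (2 * \<beta> + 1))
      + card K * (m + 1) * ((n div 4 ^ \<beta> + 1) * (2 * \<beta> + 1) + 10 * (m + 1)))"
    unfolding BB(1) by (simp only: B_def M1_def M2_def M3_def)
  have "circuit_depth gs \<le> 9 * (2 * length Ls + 1)"
    unfolding gs_def by (rule circuit_depth_compute) (rule okL)
  also have "length Ls = 11" by (simp add: Ls_def)
  finally have "circuit_depth gs \<le> 207" by simp
  moreover have "wf_gate g" if "g \<in> set gs" for g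
    using wf_compute[of F Ls n g] okL that unfolding gs_def by blast
  ultimately show ?thesis using run size by blast
qed

section \<open>Size estimates\<close>

text \<open>The constant is 7^2, so that taking roots gives (b + 1)^2 <= 7 sqrt(2^b). From b = 5 on,
  the left side grows per step by at most (7/6)^4 < 2.\<close>

lemma poly4_le: "(real b + 1) ^ 4 \<le> 49 * 2 ^ b"
proof (induction b)
  case (Suc b)
  show ?case
  proof (cases "b < 5")
    case True
    then have "b \<in> {0, 1, 2, 3, 4}" by auto
    then show ?thesis by (auto simp: eval_nat_numeral)
  next
    case False
    then have "6 * (real (Suc b) + 1) \<le> 7 * (real b + 1)" by simp
    then have "(6 * (real (Suc b) + 1)) ^ 4 \<le> (7 * (real b + 1)) ^ 4" by (intro power_mono) auto
    then have "6 ^ 4 * (real (Suc b) + 1) ^ 4 \<le> 7 ^ 4 * (real b + 1) ^ 4"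
      by (simp only: power_mult_distrib)
    moreover have "(6 :: real) ^ 4 = 1296" "(7 :: real) ^ 4 = 2401" by simp_all
    ultimately have "1296 * (real (Suc b) + 1) ^ 4 \<le> 2401 * (real b + 1) ^ 4" by (simp only:)
    moreover have "0 \<le> (real b + 1) ^ 4" by simp
    ultimately have "(real (Suc b) + 1) ^ 4 \<le> 2 * (real b + 1) ^ 4" by linarith
    also have "\<dots> \<le> 49 * 2 ^ Suc b" using Suc by simp
    finally show ?thesis .
  qed
qed simp

text \<open>With y = 2^\<beta> the choice of \<beta> gives q <= y^3 <= 8 q, so sqrt(q) is about r^3
  for r = sqrt(y). The first two rounds cost at most about n y L^2 with L = \<beta> + 1, and L^2 <=
  7 r leaves n r^3. In the last round q / y^2 <= y leads to the same estimate.\<close>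

lemma size_bound:
  fixes n \<beta> m k :: nat and \<tau> :: real
  assumes n: "2 \<le> n" and m: "2 ^ m \<le> 2 * n" "n < 2 ^ m"
    and k: "real k \<le> \<tau>" and \<tau>: "log 2 n \<le> \<tau>" "\<tau> \<le> 2 * n"
    and \<beta>: "\<tau> * log 2 n \<le> 8 ^ \<beta>" "8 ^ \<beta> \<le> 8 * (\<tau> * log 2 n)"
  shows "real ((n div 2 ^ \<beta> + 1) * (2 ^ \<beta> + 1) * (\<beta> + 1) * (2 ^ \<beta> + 10 * (\<beta> + 1))
      + (n div 4 ^ \<beta> + 1) * (4 ^ \<beta> + 1) * (2 * \<beta> + 1) * (2 ^ \<beta> * (\<beta> + 1) + 10 * (2 * \<beta> + 1))
      + k * (m + 1) * ((n div 4 ^ \<beta> + 1) * (2 * \<beta> + 1) + 10 * (m + 1)))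
     \<le> 25000 * real n * sqrt (\<tau> * log 2 n)"
proof -
  define N where "N = real n"
  define l where "l = log 2 n"
  define q where "q = \<tau> * l"
  define y :: real where "y = 2 ^ \<beta>"
  define r where "r = sqrt y"
  define L where "L = real \<beta> + 1"
  define s where "s = sqrt q"
  define M where "M = real m + 1"
  have N: "2 \<le> N" using n by (simp add: N_def)
  have l1: "1 \<le> l" using n by (simp add: l_def)
  have lm: "l \<le> real m"
    using m(2) n by (simp add: l_def log2_of_power_le)
  have ml: "real m \<le> l + 1"
  proof -
    have "real m \<le> log 2 (real (2 * n))" by (rule le_log2_of_power[OF m(1)])
    also have "\<dots> = l + 1" using n by (simp add: l_def log_mult)
    finally show ?thesis .
  qed
  have \<tau>1: "1 \<le> \<tau>" using \<tau>(1) l1 by (simp add: l_def)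
  have q1: "1 \<le> q" unfolding q_def using mult_mono[of 1 \<tau> 1 l] \<tau>1 l1 by simp
  have y1: "1 \<le> y" by (simp add: y_def)
  have y3: "q \<le> y ^ 3" "y ^ 3 \<le> 8 * q"
  proof -
    have "y ^ 3 = (2 ^ 3) ^ \<beta>" unfolding y_def by (simp only: power_mult[symmetric] mult.commute)
    then have "y ^ 3 = 8 ^ \<beta>" by simp
    then show "q \<le> y ^ 3" "y ^ 3 \<le> 8 * q" using \<beta> by (simp_all add: q_def l_def)
  qed
  have r1: "1 \<le> r" using y1 by (simp add: r_def)
  have r2: "r ^ 2 = y" using y1 by (simp add: r_def)
  have s1: "1 \<le> s" "s ^ 2 = q" using q1 by (simp_all add: s_def)
  have r3: "r ^ 3 \<le> 3 * s"
  proof -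
    have "(r ^ 3) ^ 2 = (r ^ 2) ^ 3" by (simp only: power_mult[symmetric] mult.commute)
    also have "\<dots> = y ^ 3" by (simp only: r2)
    also have "\<dots> \<le> (3 * s) ^ 2" using y3(2) q1 by (simp add: power_mult_distrib s1)
    finally show ?thesis by (rule power2_le_imp_le) (use s1 in auto)
  qed
  have L1: "1 \<le> L" by (simp add: L_def)
  have L2: "L ^ 2 \<le> 7 * r"
  proof -
    have "(L ^ 2) ^ 2 = L ^ 4" by (simp flip: power_mult)
    also have "\<dots> \<le> 49 * y" using poly4_le[of \<beta>] by (simp add: L_def y_def)
    also have "\<dots> = (7 * r) ^ 2" by (simp add: power_mult_distrib r2)
    finally show ?thesis by (rule power2_le_imp_le) (use r1 in auto)
  qed
  have LL: "L \<le> L ^ 2" using L1 by (simp add: power2_eq_square)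
  have mpow: "(real m + 1) ^ 4 \<le> 98 * N"
  proof -
    have "real (2 ^ m) \<le> real (2 * n)" using m(1) by (simp only: of_nat_le_iff)
    then show ?thesis using poly4_le[of m] by (simp add: N_def)
  qed
  have l4: "l ^ 4 \<le> 98 * N"
  proof -
    have "l ^ 4 \<le> (real m + 1) ^ 4" using lm l1 by (intro power_mono) auto
    with mpow show ?thesis by linarith
  qed
  have l3: "l ^ 3 \<le> 98 * N"
    using l4 power_increasing[of 3 4 l] l1 by simp
  have l2: "l ^ 2 \<le> 4 * N"
  proof -
    have "real m ^ 2 \<le> 2 * 2 ^ m"
    proof -
      have "j ^ 2 \<le> 2 * 2 ^ j" for j :: nat
      proof (induction j)
        case (Suc j)
        show ?case
        proof (cases "j < 3")
          case True
          then have "j \<in> {0, 1, 2}" by auto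
          then show ?thesis by (auto simp: power2_eq_square)
        next
          case False
          then have "3 * j \<le> j * j" by (intro mult_le_mono) auto
          moreover have "2 * j + 1 \<le> 3 * j" using False by simp
          ultimately have "2 * j + 1 \<le> j * j" by (rule order.trans[rotated])
          then have "(Suc j) ^ 2 \<le> 2 * j ^ 2" by (simp add: power2_eq_square)
          with Suc show ?thesis by simp
        qed
      qed simp
      from this[of m] have "real (m ^ 2) \<le> real (2 * 2 ^ m)" by (simp only: of_nat_le_iff)
      then show ?thesis by simp
    qed
    also have "\<dots> \<le> 4 * N"
    proof -
      have "real (2 ^ m) \<le> real (2 * n)" using m(1) by (simp only: of_nat_le_iff)
      then show ?thesis by (simp add: N_def)
    qed
    finally have "real m ^ 2 \<le> 4 * N" .
    moreover have "l ^ 2 \<le> real m ^ 2" using lm l1 by (intro power_mono) auto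
    ultimately show ?thesis by linarith
  qed
  have q2N: "q \<le> 2 * N * l" unfolding q_def N_def using \<tau>(2) l1 by (intro mult_right_mono) auto
  \<comment> \<open>Large blocks exceed n at most by a constant factor, so the \<open>+ 1\<close> in
    the number of blocks is harmless. The 11 comes from 1024 <= 11^3.\<close>
  have y2: "y ^ 2 \<le> 11 * N"
  proof -
    have "(y ^ 2) ^ 3 = (y ^ 3) ^ 2" by (simp only: power_mult[symmetric] mult.commute)
    also have "\<dots> \<le> (8 * (2 * N * l)) ^ 2"
      using y3(2) q2N y1 by (intro power_mono) auto
    also have "\<dots> = 256 * N ^ 2 * l ^ 2" by (simp add: power_mult_distrib)
    also have "\<dots> \<le> 256 * N ^ 2 * (4 * N)" using l2 by (intro mult_left_mono) auto
    also have "\<dots> = 1024 * N ^ 3" by (simp add: eval_nat_numeral)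
    also have "\<dots> \<le> (11 * N) ^ 3" using N by (simp add: power_mult_distrib)
    finally show ?thesis using N power_mono_iff[of "y ^ 2" "11 * N" 3] by simp
  qed
  have yy: "y \<le> y ^ 2" using y1 by (simp add: power2_eq_square)
  have "((2 :: real) ^ 2) ^ \<beta> = y ^ 2"
    unfolding y_def by (simp only: power_mult[symmetric] mult.commute)
  then have four: "(4 :: real) ^ \<beta> = y ^ 2" by simp
  have d1: "real (n div 2 ^ \<beta>) \<le> N / y"
    using of_nat_div_le_of_nat[of n "2 ^ \<beta>", where 'a=real] by (simp add: N_def y_def)
  have d2: "real (n div 4 ^ \<beta>) \<le> N / y ^ 2"
    using of_nat_div_le_of_nat[of n "4 ^ \<beta>", where 'a=real] by (simp add: N_def four)
  have g: "(N / Y + 1) * (Y + 1) \<le> 14 * N" if "1 \<le> Y" "Y \<le> 11 * N" for Y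
  proof -
    have "(a + 1) * (Y + 1) = a * Y + a + Y + 1" for a :: real by (simp add: algebra_simps)
    from this[of "N / Y"] have "(N / Y + 1) * (Y + 1) = N + N / Y + Y + 1" using that by simp
    moreover have "N / Y \<le> N" using that N by (simp add: divide_le_eq)
    ultimately show ?thesis using that N by linarith
  qed
  have r13: "r \<le> r ^ 3" using power_increasing[of 1 3 r] r1 by simp
  have Ly: "L * y \<le> 7 * r ^ 3" "L ^ 2 * y \<le> 7 * r ^ 3"
  proof -
    have "L ^ 2 * y \<le> 7 * r * r ^ 2" unfolding r2 using L2 y1 by (intro mult_right_mono) auto
    then show *: "L ^ 2 * y \<le> 7 * r ^ 3" by (simp add: power3_eq_cube power2_eq_square)
    have "L * y \<le> L ^ 2 * y" using LL y1 by (intro mult_right_mono) auto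
    with * show "L * y \<le> 7 * r ^ 3" by simp
  qed
  have T1: "real ((n div 2 ^ \<beta> + 1) * (2 ^ \<beta> + 1) * (\<beta> + 1) * (2 ^ \<beta> + 10 * (\<beta> + 1))) \<le> 3234 * N * s"
  proof -
    have "real ((n div 2 ^ \<beta> + 1) * (2 ^ \<beta> + 1) * (\<beta> + 1) * (2 ^ \<beta> + 10 * (\<beta> + 1)))
       = (real (n div 2 ^ \<beta>) + 1) * (y + 1) * (L * (y + 10 * L))"
      unfolding y_def L_def
      by (simp only: of_nat_mult of_nat_add of_nat_1 of_nat_power of_nat_numeral mult.assoc)
    also have "\<dots> \<le> (N / y + 1) * (y + 1) * (L * (y + 10 * L))"
      using d1 y1 L1 by (intro mult_right_mono) auto
    also have "\<dots> \<le> 14 * N * (L * (y + 10 * L))"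
      using g[OF y1] yy y2 y1 L1 by (intro mult_right_mono) auto
    also have "L * (y + 10 * L) = L * y + 10 * L ^ 2" by (simp add: algebra_simps power2_eq_square)
    also have "14 * N * (L * y + 10 * L ^ 2) \<le> 14 * N * (231 * s)"
      using Ly(1) L2 r13 r3 N by (intro mult_left_mono) linarith+
    finally show ?thesis by simp
  qed
  have T2: "real ((n div 4 ^ \<beta> + 1) * (4 ^ \<beta> + 1) * (2 * \<beta> + 1) * (2 ^ \<beta> * (\<beta> + 1) + 10 * (2 * \<beta> + 1)))
     \<le> 12348 * N * s"
  proof -
    have b: "real (2 * \<beta> + 1) \<le> 2 * L" by (simp add: L_def)
    have "real ((n div 4 ^ \<beta> + 1) * (4 ^ \<beta> + 1) * (2 * \<beta> + 1) * (2 ^ \<beta> * (\<beta> + 1) + 10 * (2 * \<beta> + 1)))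
       = (real (n div 4 ^ \<beta>) + 1) * (y ^ 2 + 1) * (real (2 * \<beta> + 1) * (y * L + 10 * real (2 * \<beta> + 1)))"
      unfolding four[symmetric] L_def
      by (simp only: y_def of_nat_mult of_nat_add of_nat_1 of_nat_power of_nat_numeral mult.assoc)
    also have "\<dots> \<le> (N / y ^ 2 + 1) * (y ^ 2 + 1) * (real (2 * \<beta> + 1) * (y * L + 10 * real (2 * \<beta> + 1)))"
      using d2 y1 L1 by (intro mult_right_mono) auto
    also have "\<dots> \<le> 14 * N * (real (2 * \<beta> + 1) * (y * L + 10 * real (2 * \<beta> + 1)))"
      using g[of "y ^ 2"] yy y2 y1 L1 by (intro mult_right_mono) auto
    also have "\<dots> \<le> 14 * N * ((2 * L) * (y * L + 10 * (2 * L)))"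
      using b N y1 L1 by (intro mult_left_mono mult_mono add_left_mono) auto
    also have "(2 * L) * (y * L + 10 * (2 * L)) = 2 * (L ^ 2 * y) + 40 * L ^ 2"
      by (simp add: algebra_simps power2_eq_square)
    also have "14 * N * (2 * (L ^ 2 * y) + 40 * L ^ 2) \<le> 14 * N * (882 * s)"
      using Ly(2) L2 r13 r3 N by (intro mult_left_mono) linarith+
    finally show ?thesis by simp
  qed
  have M: "M \<le> 3 * l" "0 \<le> M" using ml l1 by (simp_all add: M_def)
  have kM: "real k * M \<le> 3 * q"
    using mult_mono[OF k M(1)] M \<tau>1 by (simp add: q_def)
  have T3: "real (k * (m + 1) * ((n div 4 ^ \<beta> + 1) * (2 * \<beta> + 1) + 10 * (m + 1))) \<le> 5292 * N * s"
  proof -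
    have b: "real (2 * \<beta> + 1) \<le> 2 * L" by (simp add: L_def)
    have e: "N / y ^ 2 + 1 \<le> 12 * N / y ^ 2"
    proof -
      have "1 \<le> 11 * N / y ^ 2" using y2 y1 by (simp add: le_divide_eq)
      moreover have "12 * N / y ^ 2 = N / y ^ 2 + 11 * N / y ^ 2"
        by (simp add: add_divide_distrib[symmetric])
      ultimately show ?thesis by linarith
    qed
    define P where "P = real k * M"
    have P: "0 \<le> P" "P \<le> 3 * q" using kM M by (simp_all add: P_def)
    have "real (k * (m + 1) * ((n div 4 ^ \<beta> + 1) * (2 * \<beta> + 1) + 10 * (m + 1)))
      = P * ((real (n div 4 ^ \<beta>) + 1) * real (2 * \<beta> + 1)) + 10 * P * M"
      by (simp add: P_def M_def algebra_simps)
    also have "\<dots> \<le> 3 * q * ((12 * N / y ^ 2) * (2 * L)) + 10 * (3 * q) * (3 * l)"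
    proof (intro add_mono mult_mono)
      show "real (n div 4 ^ \<beta>) + 1 \<le> 12 * N / y ^ 2" using d2 e by linarith
    qed (use P b M q1 N L1 l1 in auto)
    finally have 1: "real (k * (m + 1) * ((n div 4 ^ \<beta> + 1) * (2 * \<beta> + 1) + 10 * (m + 1)))
      \<le> 3 * q * ((12 * N / y ^ 2) * (2 * L)) + 10 * (3 * q) * (3 * l)" .
    have "3 * q * ((12 * N / y ^ 2) * (2 * L)) = 72 * N * (L * (q / y ^ 2))"
      by simp
    also have "\<dots> \<le> 72 * N * (L * y)"
    proof -
      have "q / y ^ 2 \<le> y"
        using y3(1) y1 by (simp add: divide_le_eq power2_eq_square power3_eq_cube mult.assoc)
      then show ?thesis using N L1 by (intro mult_left_mono) auto
    qed
    also have "\<dots> \<le> 72 * N * (21 * s)"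
      using Ly(1) r3 N by (intro mult_left_mono) linarith+
    finally have 2: "3 * q * ((12 * N / y ^ 2) * (2 * L)) \<le> 72 * N * (21 * s)" .
    \<comment> \<open>The remaining summand is of order q l = s (s l), so s l = O(N) is enough, and
      this follows from l^3 = O(N).\<close>
    have "(s * l) ^ 2 = \<tau> * l ^ 3" 
      unfolding power_mult_distrib s1 q_def by (simp add: power2_eq_square power3_eq_cube)
    also have "\<dots> \<le> 2 * N * (98 * N)"
      using \<tau>(2) l3 \<tau>1 l1 N by (intro mult_mono) (auto simp: N_def)
    also have "\<dots> = (14 * N) ^ 2" by (simp add: power2_eq_square)
    finally have sl: "s * l \<le> 14 * N" by (rule power2_le_imp_le) (use N in auto)
    have "10 * (3 * q) * (3 * l) = 90 * s * (s * l)"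
      by (simp flip: s1(2) add: power2_eq_square)
    also have "\<dots> \<le> 90 * s * (14 * N)"
      using sl s1 by (intro mult_left_mono) auto
    finally have "real (k * (m + 1) * ((n div 4 ^ \<beta> + 1) * (2 * \<beta> + 1) + 10 * (m + 1)))
      \<le> 72 * N * (21 * s) + 90 * s * (14 * N)" using 1 2 by linarith
    moreover have "0 \<le> N * s" using N s1 by simp
    ultimately show ?thesis by (simp add: algebra_simps)
  qed
  have "real ((n div 2 ^ \<beta> + 1) * (2 ^ \<beta> + 1) * (\<beta> + 1) * (2 ^ \<beta> + 10 * (\<beta> + 1))
      + (n div 4 ^ \<beta> + 1) * (4 ^ \<beta> + 1) * (2 * \<beta> + 1) * (2 ^ \<beta> * (\<beta> + 1) + 10 * (2 * \<beta> + 1))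
      + k * (m + 1) * ((n div 4 ^ \<beta> + 1) * (2 * \<beta> + 1) + 10 * (m + 1)))
    \<le> 3234 * N * s + 12348 * N * s + 5292 * N * s"
    unfolding of_nat_add[where 'a=real] by (intro add_mono T1[unfolded of_nat_add] T2[unfolded of_nat_add] T3[unfolded of_nat_add])
  also have "\<dots> \<le> 25000 * N * s" using N s1 by simp
  finally show ?thesis by (simp add: N_def s_def q_def l_def)
qed

text \<open>\<open>TH\<close> admits a description of the threshold by accepted or by rejected
  weights. \<open>\<tau>\<close> stands in for |K|, which may be below log n or exceed n - t by one.
  The constant is 20 * 25000.\<close>

lemma symmetric_circuit_size:
  fixes n :: nat and \<tau> :: real and c :: bool
  assumes n: "2 \<le> n" and K: "K \<noteq> {}" "K \<subseteq> {..n}"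
    and k: "real (card K) \<le> \<tau>" and \<tau>: "log 2 n \<le> \<tau>" "\<tau> \<le> 2 * n"
    and TH: "\<And>s. s \<le> n \<Longrightarrow> t \<le> s \<longleftrightarrow> ((s \<in> K) \<noteq> c)"
  shows "\<exists>gs. implements_TH n t gs \<and> circuit_depth gs \<le> 207 \<and>
    real (circuit_size gs) \<le> 500000 * real n * sqrt (\<tau> * log 2 (real n))"
proof -
  obtain m where m: "n < 2 ^ m" "2 ^ m \<le> 2 * n" using exists_log[of n] n by auto
  define q where "q = \<tau> * log 2 n"
  have l1: "1 \<le> log 2 n" using n by simp
  have q1: "1 \<le> q" unfolding q_def using mult_mono[of 1 \<tau> 1 "log 2 n"] l1 \<tau>(1) by simp
  \<comment> \<open>Minimality gives 8^\<beta> <= 8 q; for \<beta> = 0 this rests on 1 <= q.\<close>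
  define \<beta> where "\<beta> = (LEAST b. q \<le> 8 ^ b)"
  have "\<exists>b. q \<le> 8 ^ b" using real_arch_pow[of 8 q] by (auto intro: less_imp_le)
  then have \<beta>: "q \<le> 8 ^ \<beta>" unfolding \<beta>_def by (rule LeastI_ex)
  have "8 ^ \<beta> \<le> 8 * q"
  proof (cases \<beta>)
    case (Suc b)
    then have "\<not> q \<le> 8 ^ b" using not_less_Least[of b "\<lambda>b. q \<le> 8 ^ b"] by (simp add: \<beta>_def)
    then show ?thesis using Suc by simp
  qed (use q1 in simp)
  with \<beta> have "real ((n div 2 ^ \<beta> + 1) * (2 ^ \<beta> + 1) * (\<beta> + 1) * (2 ^ \<beta> + 10 * (\<beta> + 1))
      + (n div 4 ^ \<beta> + 1) * (4 ^ \<beta> + 1) * (2 * \<beta> + 1) * (2 ^ \<beta> * (\<beta> + 1) + 10 * (2 * \<beta> + 1))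
      + card K * (m + 1) * ((n div 4 ^ \<beta> + 1) * (2 * \<beta> + 1) + 10 * (m + 1)))
     \<le> 25000 * real n * sqrt (\<tau> * log 2 n)"
    by (intro size_bound n m k \<tau>) (simp_all add: q_def)
  moreover obtain gs where gs: "\<forall>g\<in>set gs. wf_gate g"
     "\<And>x z. run_circuit gs (basis (input_config n x z))
          = basis (input_config n x (z \<noteq> ((card {j. j < n \<and> x j} \<in> K) \<noteq> c)))"
     "circuit_depth gs \<le> 207"
     "circuit_size gs \<le> 20 *
       ((n div 2 ^ \<beta> + 1) * (2 ^ \<beta> + 1) * (\<beta> + 1) * (2 ^ \<beta> + 10 * (\<beta> + 1))
      + (n div 4 ^ \<beta> + 1) * (4 ^ \<beta> + 1) * (2 * \<beta> + 1) * (2 ^ \<beta> * (\<beta> + 1) + 10 * (2 * \<beta> + 1))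
      + card K * (m + 1) * ((n div 4 ^ \<beta> + 1) * (2 * \<beta> + 1) + 10 * (m + 1)))"
    using symmetric_circuit[OF K m(1), of c \<beta>] by blast
  moreover have "implements_TH n t gs"
    unfolding implements_TH_def
  proof (intro conjI allI gs(1))
    fix x z
    have "card {j. j < n \<and> x j} \<le> n" using card_mono[of "{..<n}" "{j. j < n \<and> x j}"] by auto
    from TH[OF this] show "run_circuit gs (basis (input_config n x z))
        = basis (input_config n x (z \<noteq> TH n t x))"
      by (simp only: gs(2) TH_def)
  qed
  ultimately show ?thesis
    by (intro exI[of _ gs]) (auto dest!: of_nat_mono[where 'a=real] simp: algebra_simps)
qed

theorem theorem2:
  shows "\<exists>(D::nat) (c::real). c > 0 \<and> (\<forall>n t. 2 \<le> n \<longrightarrow> 1 \<le> t \<longrightarrow> t \<le> n \<longrightarrow>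
     (((real t \<le> log 2 (real n) \<or> real n - log 2 (real n) \<le> real t) \<longrightarrow>
        (\<exists>gs. implements_TH n t gs \<and> circuit_depth gs \<le> D \<and>
              real (circuit_size gs) \<le> c * real n * log 2 (real n))) \<and>
      ((log 2 (real n) \<le> real t \<and> t \<le> nat \<lceil>real n / 2\<rceil>) \<longrightarrow>
        (\<exists>gs. implements_TH n t gs \<and> circuit_depth gs \<le> D \<and>
              real (circuit_size gs) \<le> c * real n * sqrt (real t * log 2 (real n)))) \<and>
      ((nat \<lceil>real n / 2\<rceil> \<le> t \<and> real t \<le> real n - log 2 (real n)) \<longrightarrow>
        (\<exists>gs. implements_TH n t gs \<and> circuit_depth gs \<le> D \<and>
              real (circuit_size gs) \<le> c * real n * sqrt (real (n - t) * log 2 (real n))))))"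
proof (intro exI[of _ "207 :: nat"] exI[of _ "1000000 :: real"] conjI allI impI)
  fix n t :: nat
  assume n: "2 \<le> n" and t: "1 \<le> t" "t \<le> n"
  define l where "l = log 2 (real n)"
  have l1: "1 \<le> l" using n by (simp add: l_def)
  have ln: "l \<le> n" using n log2_of_power_le[of n n] by (simp add: l_def less_imp_le)
  \<comment> \<open>The t rejected weights, with the answer negated.\<close>
  have low: "\<exists>gs. implements_TH n t gs \<and> circuit_depth gs \<le> 207 \<and>
    real (circuit_size gs) \<le> 500000 * real n * sqrt (\<tau> * l)"
    if "real t \<le> \<tau>" "l \<le> \<tau>" "\<tau> \<le> 2 * n" for \<tau>
    unfolding l_def
    by (rule symmetric_circuit_size[where K="{..<t}" and c=True]) (use n t that in \<open>auto simp: l_def lessThan_empty_iff\<close>)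
  \<comment> \<open>The n - t + 1 accepted weights, without negation.\<close>
  have high: "\<exists>gs. implements_TH n t gs \<and> circuit_depth gs \<le> 207 \<and>
    real (circuit_size gs) \<le> 500000 * real n * sqrt (\<tau> * l)"
    if "real n - real t + 1 \<le> \<tau>" "l \<le> \<tau>" "\<tau> \<le> 2 * n" for \<tau>
    unfolding l_def
    by (rule symmetric_circuit_size[where K="{t..n}" and c=False]) (use n t that in \<open>auto simp: l_def of_nat_diff\<close>)
  \<comment> \<open>Doubling the constant pays for a \<open>\<tau>\<close> that is twice the wanted
    quantity.\<close>
  have le: "a \<le> 1000000 * real n * u" if "a \<le> 500000 * real n * sqrt v" "v \<le> (2 * u) ^ 2" "0 \<le> u" for a u v
  proof -
    have "sqrt v \<le> 2 * u" using that(2,3) by (intro real_le_lsqrt) auto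
    then have "500000 * real n * sqrt v \<le> 500000 * real n * (2 * u)" by (intro mult_left_mono) auto
    also have "\<dots> = 1000000 * real n * u" by simp
    finally show ?thesis using that(1) by linarith
  qed
  {
    assume "real t \<le> log 2 (real n) \<or> real n - log 2 (real n) \<le> real t"
    \<comment> \<open>\<tau> = 2 l serves both ends: at the upper end n - t + 1 <= l + 1 <= 2
      l.\<close>
    then have "\<exists>gs. implements_TH n t gs \<and> circuit_depth gs \<le> 207 \<and>
      real (circuit_size gs) \<le> 500000 * real n * sqrt (2 * l * l)"
      using low[of "2 * l"] high[of "2 * l"] l1 ln by (fold l_def) auto
    moreover have "2 * l * l \<le> (2 * l) ^ 2" by (simp add: power2_eq_square)
    ultimately show "\<exists>gs. implements_TH n t gs \<and> circuit_depth gs \<le> 207 \<and>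
        real (circuit_size gs) \<le> 1000000 * real n * log 2 (real n)"
      using le[of _ "2 * l * l" l] l1 by (fold l_def) fastforce
  next
    assume "log 2 (real n) \<le> real t \<and> t \<le> nat \<lceil>real n / 2\<rceil>"
    then have "\<exists>gs. implements_TH n t gs \<and> circuit_depth gs \<le> 207 \<and>
      real (circuit_size gs) \<le> 500000 * real n * sqrt (real t * l)"
      using low[of "real t"] t by (fold l_def) auto
    moreover have "real t * l \<le> (2 * sqrt (real t * l)) ^ 2"
      using l1 by (simp add: power_mult_distrib)
    ultimately show "\<exists>gs. implements_TH n t gs \<and> circuit_depth gs \<le> 207 \<and>
        real (circuit_size gs) \<le> 1000000 * real n * sqrt (real t * log 2 (real n))"
      using le[of _ "real t * l" "sqrt (real t * l)"] l1 by (fold l_def) fastforce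
  next
    assume "nat \<lceil>real n / 2\<rceil> \<le> t \<and> real t \<le> real n - log 2 (real n)"
    then have "l \<le> real (n - t)" using t by (simp add: l_def of_nat_diff)
    \<comment> \<open>n - t >= l >= 1 gives n - t + 1 <= 2 (n - t), which is the choice of
      \<tau>.\<close>
    then have "\<exists>gs. implements_TH n t gs \<and> circuit_depth gs \<le> 207 \<and>
      real (circuit_size gs) \<le> 500000 * real n * sqrt (2 * real (n - t) * l)"
      using t l1 by (intro high) (auto simp: of_nat_diff)
    moreover have "2 * real (n - t) * l \<le> (2 * sqrt (real (n - t) * l)) ^ 2"
      using l1 by (simp add: power_mult_distrib)
    ultimately show "\<exists>gs. implements_TH n t gs \<and> circuit_depth gs \<le> 207 \<and>
        real (circuit_size gs) \<le> 1000000 * real n * sqrt (real (n - t) * log 2 (real n))"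
      using le[of _ "2 * real (n - t) * l" "sqrt (real (n - t) * l)"] l1 by (fold l_def) fastforce
  }
qed simp

end
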